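(* Let $d\ge 3$ be a fixed integer, $\varepsilon\in(0,1/2]$ fixed, and $b=1/(8\ln d)$. Let $\delta<\min(1/16,\,b\varepsilon)$. Then any deterministic (adaptive) algorithm for the NoisyParities$(d,\varepsilon)$ problem on $n$-vertex instances which makes at most $n^{1/2+\delta}$ queries outputs the correct answer (YES or NO) with probability at most $1/2+o(1)$ as $n\to\infty$.
   Context: NoisyParities$(d,\varepsilon)$: An adversary samples a random $d$-regular multigraph $G=(V,E)$ on $n$ vertices from the configuration model (each vertex gets $d$ half-edges and half-edges are paired uniformly at random; self-loops and parallel edges allowed). With probability $1/2$ each, the adversary is in the YES case or NO case, and generates edge labels $Y\in\{0,1\}^E$: in the YES case, the labels $Y(e)$ are independent uniform bits; in the NO case, $X\in\{0,1\}^V$ is uniform, independently $Z\in\{0,1\}^E$ has independent Bernoulli$(\varepsilon)$ entries, and $Y(e)=X(u)+X(v)+Z(e)\pmod 2$ for $e=(u,v)$. The algorithm adaptively queries vertices $q\in V$; each query returns all edges incident on $q$ together with their labels. The algorithm must decide whether it is in the YES or the NO case; probability is over the random instance. *)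

theory Defs
  imports "HOL-Probability.Probability" "HOL-Library.Multiset"
begin

text \<open>Configuration model on n vertices, each of degree d.
  Vertices are 0..<n; half-edges are 0..<n*d; half-edge h belongs to vertex h div d.
  A pairing is a fixed-point-free involution on the half-edges (identity outside).
  The edge formed by half-edges h and p h is identified by its representative min h (p h).\<close>

definition pairings :: "nat \<Rightarrow> nat \<Rightarrow> (nat \<Rightarrow> nat) set" where
  "pairings n d = {p. (\<forall>h<n*d. p h < n*d \<and> p h \<noteq> h \<and> p (p h) = h) \<and> (\<forall>h. n*d \<le> h \<longrightarrow> p h = h)}"

text \<open>An np_instance: pairing p and edge labels Y given on half-edges (Y h = Y (p h)).\<close>
type_synonym np_instance = "(nat \<Rightarrow> nat) \<times> (nat \<Rightarrow> bool)"

definition coin :: "bool pmf" where "coin = bernoulli_pmf (1/2)"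

definition yes_labels :: "nat \<Rightarrow> nat \<Rightarrow> (nat \<Rightarrow> nat) \<Rightarrow> (nat \<Rightarrow> bool) pmf" where
  "yes_labels n d p = map_pmf (\<lambda>c h. c (min h (p h))) (Pi_pmf {..<n*d} False (\<lambda>_. coin))"

text \<open>NO case: Y(e) = X(u) + X(v) + Z(e) mod 2 (xor on bool).\<close>
definition no_labels :: "nat \<Rightarrow> nat \<Rightarrow> real \<Rightarrow> (nat \<Rightarrow> nat) \<Rightarrow> (nat \<Rightarrow> bool) pmf" where
  "no_labels n d \<epsilon> p =
     do { X \<leftarrow> Pi_pmf {..<n} False (\<lambda>_. coin);
          Z \<leftarrow> Pi_pmf {..<n*d} False (\<lambda>_. bernoulli_pmf \<epsilon>);
          return_pmf (\<lambda>h. (X (h div d) \<noteq> X (p h div d)) \<noteq> Z (min h (p h))) }"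

definition noisy_parities :: "nat \<Rightarrow> nat \<Rightarrow> real \<Rightarrow> (bool \<times> np_instance) pmf" where
  "noisy_parities n d \<epsilon> =
     do { p \<leftarrow> pmf_of_set (pairings n d);
          yes \<leftarrow> coin;
          Y \<leftarrow> (if yes then yes_labels n d p else no_labels n d \<epsilon> p);
          return_pmf (yes, (p, Y)) }"

text \<open>Answer to a query of vertex q: the multiset of incident edges (one entry per
  half-edge of q), each given as (other endpoint, label).\<close>
type_synonym answer = "(nat \<times> bool) multiset"

definition query :: "nat \<Rightarrow> np_instance \<Rightarrow> nat \<Rightarrow> answer" where
  "query d I q = mset (map (\<lambda>h. (fst I h div d, snd I h)) [q*d..<q*d+d])"

text \<open>Deterministic adaptive algorithm: given the history of (query, answer) pairs,
  either queries a vertex (Inl v) or outputs a decision (Inr b, True = YES).\<close>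
type_synonym algorithm = "(nat \<times> answer) list \<Rightarrow> nat + bool"

fun exec :: "nat \<Rightarrow> algorithm \<Rightarrow> np_instance \<Rightarrow> nat \<Rightarrow> (nat \<times> answer) list \<Rightarrow> bool option" where
  "exec d A I 0 hist = (case A hist of Inr b \<Rightarrow> Some b | Inl _ \<Rightarrow> None)"
| "exec d A I (Suc k) hist = (case A hist of Inr b \<Rightarrow> Some b
                               | Inl v \<Rightarrow> exec d A I k (hist @ [(v, query d I v)]))"

definition at_most_queries :: "nat \<Rightarrow> nat \<Rightarrow> nat \<Rightarrow> algorithm \<Rightarrow> bool" where
  "at_most_queries n d k A \<longleftrightarrow>
     (\<forall>p\<in>pairings n d. \<forall>Y. (\<forall>h. Y h = Y (p h)) \<longrightarrow> exec d A (p, Y) k [] \<noteq> None)"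

definition success_prob :: "nat \<Rightarrow> nat \<Rightarrow> real \<Rightarrow> nat \<Rightarrow> algorithm \<Rightarrow> real" where
  "success_prob n d \<epsilon> k A =
     measure_pmf.prob (noisy_parities n d \<epsilon>) {(yes, I). exec d A I k [] = Some yes}"

end

theory Submission
  imports Defs
begin

text \<open>
  Reveal the partner and the label of one half-edge at a time, and call a reveal a collision if the
  partner's vertex was already seen. The other edges form a forest. Let \<open>\<lambda> = 1 - 2 \<epsilon>\<close>.
  Relative to uniform labels, the likelihood \<open>L\<close> of the revealed labels in the NO case is a sum over
  sets \<open>C\<close> of collision edges; up to sign the term of \<open>C\<close> is \<open>\<lambda>\<close> to the power \<open>|C| + |J|\<close>, where \<open>J\<close>
  is the subforest whose odd-degree vertices are the endpoints of \<open>C\<close> (and 0 if there is none).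
  If all collision endpoints are pairwise at forest distance more than \<open>2 r\<close>, then by parity \<open>J\<close>
  leaves each of the \<open>r\<close> concentric balls around each of its \<open>2 |C|\<close> odd vertices, so that
  \<open>|J| \<ge> 2 r |C|\<close>. With at most \<open>R\<close> collisions, \<open>|L - 1| \<le> (1 + \<lambda>^(2 r))^R - 1\<close>. This holds
  for every outcome of the labels, so adaptivity does not matter.

  For \<open>2 r\<close> close to \<open>b ln n\<close>, a ball of radius \<open>2 r\<close> has at most \<open>n^(1/4)\<close> vertices. There are about
  \<open>n^(2 \<delta>)\<close> collisions, so two of them are close with vanishing probability, and
  \<open>R \<lambda>^(2 r)\<close> is about \<open>n^(2 \<delta> - 2 b \<epsilon>)\<close>, which tends to 0.
\<close>

section \<open>Spin correlations on a forest with chords\<close>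

text \<open>Bits become signs, so that the xor of two endpoint bits becomes a product.\<close>

definition spin :: "(nat \<Rightarrow> bool) \<Rightarrow> nat \<Rightarrow> real" where
  "spin X v = (if X v then -1 else 1)"

definition configs :: "nat \<Rightarrow> (nat \<Rightarrow> bool) set" where
  "configs n = PiE_dflt {..<n} False (\<lambda>_. UNIV)"

definition avg :: "nat \<Rightarrow> ((nat \<Rightarrow> bool) \<Rightarrow> real) \<Rightarrow> real" where
  "avg n f = (\<Sum>X\<in>configs n. f X) / 2 ^ n"

lemma finite_configs [simp]: "finite (configs n)"
  unfolding configs_def by (intro finite_PiE_dflt) auto

lemma card_configs: "card (configs n) = 2 ^ n"
  unfolding configs_def by (subst card_PiE_dflt) auto

lemma configs_upd: "X \<in> configs n \<Longrightarrow> w < n \<Longrightarrow> X(w := b) \<in> configs n"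
  by (auto simp: configs_def PiE_dflt_def)

lemma spin_sq [simp]: "spin X v * spin X v = 1" "spin X v * (spin X v * c) = c"
  by (auto simp: spin_def)

lemma spin_upd: "spin (X(w := b)) v = (if v = w then (if b then -1 else 1) else spin X v)"
  by (auto simp: spin_def)

lemma avg_add: "avg n (\<lambda>X. f X + g X) = avg n f + avg n g"
  by (simp add: avg_def sum.distrib add_divide_distrib)

lemma avg_cmult: "avg n (\<lambda>X. c * f X) = c * avg n f"
  by (simp add: avg_def sum_distrib_left)

lemma avg_cong: "(\<And>X. f X = g X) \<Longrightarrow> avg n f = avg n g"
  by (simp add: avg_def)

text \<open>Flipping the bit of \<open>w\<close> is an involution of \<open>configs n\<close> that
  negates the summand.\<close>

lemma avg_spin_mult_eq_0:
  assumes "w < n" "\<And>X b. g (X(w := b)) = g X"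
  shows "avg n (\<lambda>X. spin X w * g X) = 0"
proof -
  have "(\<Sum>X\<in>configs n. spin X w * g X) =
        (\<Sum>X\<in>configs n. spin (X(w := \<not> X w)) w * g (X(w := \<not> X w)))"
    by (rule sum.reindex_bij_witness[where i = "\<lambda>X. X(w := \<not> X w)" and j = "\<lambda>X. X(w := \<not> X w)"])
       (auto simp: configs_upd assms(1))
  also have "\<dots> = (\<Sum>X\<in>configs n. - (spin X w * g X))"
    by (intro sum.cong refl) (auto simp: assms(2) spin_def)
  finally show ?thesis by (simp add: avg_def sum_negf)
qed

section \<open>Averages of edge weights over a forest\<close>

type_synonym wedge = "nat \<times> nat \<times> real"

text \<open>With \<open>a\<close> equal to plus or minus \<open>1 - 2 * \<epsilon>\<close> according
  to the label, a factor is the likelihood ratio of that label given the spins, NO case against a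
  fair bit.\<close>

definition weight :: "(nat \<Rightarrow> bool) \<Rightarrow> wedge list \<Rightarrow> real" where
  "weight X T = (\<Prod>(u, w, a)\<leftarrow>T. 1 + a * spin X u * spin X w)"

lemma weight_Nil [simp]: "weight X [] = 1"
  and weight_Cons [simp]: "weight X ((u, w, a) # T) = (1 + a * spin X u * spin X w) * weight X T"
  by (simp_all add: weight_def)

abbreviation pairs_of :: "wedge list \<Rightarrow> (nat \<times> nat) set" where
  "pairs_of T \<equiv> (\<lambda>(u, w, a). (u, w)) ` set T"

text \<open>The most recent edge is at the head of the list and \<open>w\<close> is its new leaf.\<close>
fun leafy :: "nat \<Rightarrow> wedge list \<Rightarrow> bool" where
  "leafy n [] = True"
| "leafy n ((u, w, a) # T) \<longleftrightarrow> leafy n T \<and> u \<noteq> w \<and> u < n \<and> w < n \<and>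
     (\<forall>(x, y, b)\<in>set T. w \<noteq> x \<and> w \<noteq> y)"

lemma weight_upd:
  "\<forall>(x, y, b)\<in>set T. w \<noteq> x \<and> w \<noteq> y \<Longrightarrow> weight (X(w := c)) T = weight X T"
  by (induction T) (auto simp: spin_upd)

text \<open>The newest leaf \<open>w\<close> occurs in no older factor, so the term containing its
  spin averages to 0 and the edge can be removed.\<close>

lemma avg_forest_weight: "leafy n T \<Longrightarrow> avg n (\<lambda>X. weight X T) = 1"
proof (induction T)
  case Nil
  then show ?case by (simp add: avg_def card_configs)
next
  case (Cons e T)
  obtain u w a where e: "e = (u, w, a)" by (cases e) auto
  have "avg n (\<lambda>X. weight X (e # T)) =
        avg n (\<lambda>X. weight X T + spin X w * (a * spin X u * weight X T))"
    by (intro avg_cong) (simp add: e algebra_simps)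
  also have "\<dots> = avg n (\<lambda>X. weight X T)"
    unfolding avg_add using Cons.prems
    by (subst avg_spin_mult_eq_0) (auto simp: e weight_upd spin_upd)
  finally show ?case using Cons by (simp add: e)
qed

text \<open>The set on the left is the symmetric difference of \<open>P\<close> and
  \<open>{u, w}\<close>. If \<open>B\<close> contains both or neither of \<open>u\<close> and
  \<open>w\<close>, the intersection with \<open>B\<close> changes in size by 0 or 2.\<close>

lemma odd_card_toggle:
  assumes "finite P" "u \<noteq> w" "w \<in> P" "(u \<in> B) = (w \<in> B)"
  shows "odd (card ((if u \<in> P then P - {u, w} else insert u (P - {w})) \<inter> B)) = odd (card (P \<inter> B))"
proof (cases "u \<in> B")
  case True
  show ?thesis
  proof (cases "u \<in> P")
    case True
    have "card (P \<inter> B) = card (insert u (insert w ((P - {u, w}) \<inter> B)))"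
      using \<open>u \<in> B\<close> True assms by (intro arg_cong[where f = card]) auto
    also have "\<dots> = Suc (Suc (card ((P - {u, w}) \<inter> B)))"
      using assms by (subst card_insert_disjoint; auto)+
    finally show ?thesis using True by simp
  next
    case False
    have "card (P \<inter> B) = card (insert w ((P - {w}) \<inter> B))"
      using \<open>u \<in> B\<close> assms by (intro arg_cong[where f = card]) auto
    also have "\<dots> = Suc (card ((P - {w}) \<inter> B))"
      using assms by (subst card_insert_disjoint) auto
    also have "\<dots> = card (insert u ((P - {w}) \<inter> B))"
      using assms False by (subst card_insert_disjoint) auto
    finally show ?thesis using False \<open>u \<in> B\<close> by simp
  qed
next
  case False
  then have "(if u \<in> P then P - {u, w} else insert u (P - {w})) \<inter> B = P \<inter> B"
    using assms by auto
  then show ?thesis by simp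
qed

lemma prod_spin_insert:
  "finite P \<Longrightarrow> spin X u * (\<Prod>x\<in>P. spin X x) =
     (\<Prod>x\<in>(if u \<in> P then P - {u} else insert u P). spin X x)"
  by (auto simp: prod.remove)

text \<open>\<open>J\<close> is the subforest whose odd-degree vertices are \<open>P\<close>; the last conjunct is the handshake
  lemma for its edge boundary.\<close>
lemma avg_forest_spins:
  assumes "leafy n T" "\<forall>(u, w, a)\<in>set T. \<bar>a\<bar> \<le> l" "0 \<le> l" "l \<le> 1" "finite P" "P \<subseteq> {..<n}"
  defines "E \<equiv> avg n (\<lambda>X. weight X T * (\<Prod>x\<in>P. spin X x))"
  shows "E = 0 \<or> (\<exists>J\<subseteq>pairs_of T. \<bar>E\<bar> \<le> l ^ card J \<and>
           (\<forall>B. odd (card (P \<inter> B)) \<longrightarrow> (\<exists>(u, w)\<in>J. (u \<in> B) \<noteq> (w \<in> B))))"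
  unfolding E_def using assms(1,2,5,6)
proof (induction T arbitrary: P)
  case Nil
  show ?case
  proof (cases "P = {}")
    case True
    then show ?thesis by (auto simp: avg_def card_configs)
  next
    case False
    then obtain w where w: "w \<in> P" by auto
    have "avg n (\<lambda>X. weight X [] * (\<Prod>x\<in>P. spin X x)) =
          avg n (\<lambda>X. spin X w * (\<Prod>x\<in>P - {w}. spin X x))"
      using w Nil by (intro avg_cong) (simp add: prod.remove)
    also have "\<dots> = 0"
      using w Nil by (intro avg_spin_mult_eq_0) (auto simp: spin_upd intro!: prod.cong)
    finally show ?thesis by simp
  qed
next
  case (Cons e T)
  obtain u w a where e: "e = (u, w, a)" by (cases e) auto
  have prems: "leafy n T" "u \<noteq> w" "u < n" "w < n" "\<forall>(x, y, b)\<in>set T. w \<noteq> x \<and> w \<noteq> y"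
    "\<forall>(u, w, a)\<in>set T. \<bar>a\<bar> \<le> l" "\<bar>a\<bar> \<le> l" "finite P" "P \<subseteq> {..<n}"
    using Cons.prems by (auto simp: e)
  show ?case
  proof (cases "w \<in> P")
    \<comment> \<open>No other factor contains the spin of \<open>w\<close>, so only the constant 1
      of its edge factor survives, and \<open>J\<close> avoids this edge.\<close>
    case False
    have "avg n (\<lambda>X. weight X (e # T) * (\<Prod>x\<in>P. spin X x)) =
        avg n (\<lambda>X. weight X T * (\<Prod>x\<in>P. spin X x) +
           spin X w * (a * spin X u * weight X T * (\<Prod>x\<in>P. spin X x)))"
      by (intro avg_cong) (simp add: e algebra_simps)
    also have "\<dots> = avg n (\<lambda>X. weight X T * (\<Prod>x\<in>P. spin X x))"
      unfolding avg_add using prems False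
      by (subst avg_spin_mult_eq_0)
         (auto simp: weight_upd spin_upd intro!: arg_cong2[where f = "(*)"] prod.cong)
    finally have eq: "avg n (\<lambda>X. weight X (e # T) * (\<Prod>x\<in>P. spin X x)) = \<dots>" .
    have "pairs_of T \<subseteq> pairs_of (e # T)" by (intro image_mono set_subset_Cons)
    then show ?thesis unfolding eq using Cons.IH[OF prems(1,6,8,9)] by (meson subset_trans)
  next
    case True
    \<comment> \<open>The spin of \<open>w\<close> must be cancelled by its leaf edge. This puts the
      edge into \<open>J\<close> at cost \<open>a\<close> and toggles the membership of
      \<open>u\<close>.\<close>
    define Q where "Q = (if u \<in> P then P - {u, w} else insert u (P - {w}))"
    have Q: "finite Q" "Q \<subseteq> {..<n}" using prems by (auto simp: Q_def)
    have prod_Q: "spin X u * (\<Prod>x\<in>P - {w}. spin X x) = (\<Prod>x\<in>Q. spin X x)" for X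
    proof -
      have "(if u \<in> P - {w} then P - {w} - {u} else insert u (P - {w})) = Q"
        using prems by (auto simp: Q_def)
      then show ?thesis using prod_spin_insert[of "P - {w}" X u] prems by simp
    qed
    have "avg n (\<lambda>X. weight X (e # T) * (\<Prod>x\<in>P. spin X x)) =
        avg n (\<lambda>X. spin X w * (weight X T * (\<Prod>x\<in>P - {w}. spin X x)) +
           a * (weight X T * (\<Prod>x\<in>Q. spin X x)))"
      using prems(8) True
      by (intro avg_cong) (simp add: e prod.remove[of P w] prod_Q[symmetric] algebra_simps)
    also have "\<dots> = a * avg n (\<lambda>X. weight X T * (\<Prod>x\<in>Q. spin X x))"
      unfolding avg_add avg_cmult using prems
      by (subst avg_spin_mult_eq_0)
         (auto simp: weight_upd spin_upd intro!: arg_cong2[where f = "(*)"] prod.cong)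
    finally have eq: "avg n (\<lambda>X. weight X (e # T) * (\<Prod>x\<in>P. spin X x)) = \<dots>" .
    from Cons.IH[OF prems(1,6) Q] show ?thesis
    proof
      assume "avg n (\<lambda>X. weight X T * (\<Prod>x\<in>Q. spin X x)) = 0"
      then show ?thesis unfolding eq by simp
    next
      assume "\<exists>J\<subseteq>pairs_of T. \<bar>avg n (\<lambda>X. weight X T * (\<Prod>x\<in>Q. spin X x))\<bar> \<le> l ^ card J \<and>
           (\<forall>B. odd (card (Q \<inter> B)) \<longrightarrow> (\<exists>(u, w)\<in>J. (u \<in> B) \<noteq> (w \<in> B)))"
      then obtain J where J: "J \<subseteq> pairs_of T"
        "\<bar>avg n (\<lambda>X. weight X T * (\<Prod>x\<in>Q. spin X x))\<bar> \<le> l ^ card J"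
        "\<And>B. odd (card (Q \<inter> B)) \<Longrightarrow> \<exists>(u, w)\<in>J. (u \<in> B) \<noteq> (w \<in> B)" by blast
      have "finite J" using J(1) finite_surj by blast
      then have "card (insert (u, w) J) \<le> Suc (card J)" by (simp add: card_insert_if)
      then have "l * l ^ card J \<le> l ^ card (insert (u, w) J)"
        using assms(3,4) power_decreasing[of _ "Suc (card J)" l] by simp
      moreover have "\<bar>a * avg n (\<lambda>X. weight X T * (\<Prod>x\<in>Q. spin X x))\<bar> \<le> l * l ^ card J"
        unfolding abs_mult using J(2) prems(7) by (intro mult_mono) auto
      \<comment> \<open>Either \<open>(u, w)\<close> itself crosses \<open>B\<close>, or the parity
        of \<open>P\<close> on \<open>B\<close> passes to \<open>Q\<close>.\<close>
      moreover have "\<exists>(u, w)\<in>insert (u, w) J. (u \<in> B) \<noteq> (w \<in> B)" if "odd (card (P \<inter> B))" for B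
      proof (cases "(u \<in> B) = (w \<in> B)")
        case eqB: True
        then have "odd (card (Q \<inter> B))"
          unfolding Q_def using that odd_card_toggle[OF prems(8,2) True] by metis
        from J(3)[OF this] show ?thesis by blast
      qed auto
      moreover have "insert (u, w) J \<subseteq> pairs_of (e # T)" using J(1) by (auto simp: e)
      ultimately show ?thesis unfolding eq by (meson order_trans)
    qed
  qed
qed

section \<open>Balls and separated sets\<close>

definition nbrs :: "(nat \<times> nat) set \<Rightarrow> (nat \<times> nat) set" where
  "nbrs E = E \<union> E\<inverse> \<union> Id"

text \<open>As \<open>nbrs\<close> contains \<open>Id\<close>, a walk may pause, and balls grow with
  the radius.\<close>

definition ball_of :: "(nat \<times> nat) set \<Rightarrow> nat \<Rightarrow> nat set \<Rightarrow> nat set" where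
  "ball_of E i S = (nbrs E ^^ i) `` S"

lemma ball_of_Suc: "ball_of E (Suc i) S = nbrs E `` ball_of E i S"
  by (auto simp: ball_of_def)

lemma ball_of_0 [simp]: "ball_of E 0 S = S"
  by (auto simp: ball_of_def)

lemma ball_of_Suc_mono: "ball_of E i S \<subseteq> ball_of E (Suc i) S"
  unfolding ball_of_Suc by (auto simp: nbrs_def)

lemma ball_of_mono_radius: "i \<le> j \<Longrightarrow> ball_of E i S \<subseteq> ball_of E j S"
  by (rule lift_Suc_mono_le[where f = "\<lambda>i. ball_of E i S"]) (rule ball_of_Suc_mono)

lemma ball_of_mono: "E \<subseteq> F \<Longrightarrow> S \<subseteq> S' \<Longrightarrow> ball_of E i S \<subseteq> ball_of F i S'"
  by (induction i) (auto simp: ball_of_Suc nbrs_def)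

lemma subset_ball_of: "S \<subseteq> ball_of E i S"
  using ball_of_mono_radius[of 0 i E S] by simp

lemma ball_of_sym: "y \<in> ball_of E i {x} \<longleftrightarrow> x \<in> ball_of E i {y}"
proof -
  have "(nbrs E ^^ i)\<inverse> = nbrs E ^^ i"
  proof (induction i)
    case (Suc i)
    have "(nbrs E)\<inverse> = nbrs E" by (auto simp: nbrs_def)
    then show ?case using Suc by (simp add: converse_relcomp relpow_commute)
  qed simp
  then show ?thesis unfolding ball_of_def by blast
qed

lemma ball_of_trans: "y \<in> ball_of E i {x} \<Longrightarrow> z \<in> ball_of E j {y} \<Longrightarrow> z \<in> ball_of E (i + j) {x}"
  unfolding ball_of_def by (auto simp: relpow_add)

lemma ball_of_Union: "ball_of E i S = (\<Union>s\<in>S. ball_of E i {s})"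
  by (auto simp: ball_of_def)

lemma finite_ball_of: "finite E \<Longrightarrow> finite S \<Longrightarrow> finite (ball_of E i S)"
proof (induction i)
  case (Suc i)
  have "ball_of E (Suc i) S \<subseteq> ball_of E i S \<union> fst ` E \<union> snd ` E"
    by (force simp: ball_of_Suc nbrs_def)
  then show ?case using Suc by (meson finite_Un finite_imageI finite_subset)
qed simp

text \<open>A walk can visit the leaf \<open>w\<close> only from \<open>u\<close>, so it can be rerouted to wait at \<open>u\<close>.\<close>
lemma ball_of_insert_leaf:
  assumes "w \<notin> Field E" "u \<noteq> w" "x \<noteq> w" "y \<in> ball_of (insert (u, w) E) i {x}"
  shows "(if y = w then u else y) \<in> ball_of E i {x}"
  using assms(4)
proof (induction i arbitrary: y)
  case 0
  then show ?case using assms by auto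
next
  case (Suc i)
  then obtain z where z: "z \<in> ball_of (insert (u, w) E) i {x}" "(z, y) \<in> nbrs (insert (u, w) E)"
    by (auto simp: ball_of_Suc)
  have "((if z = w then u else z), (if y = w then u else y)) \<in> nbrs E"
    using z(2) assms(1,2) by (auto simp: nbrs_def Field_def)
  then show ?case using Suc.IH[OF z(1)] by (auto simp: ball_of_Suc)
qed

definition separated :: "(nat \<times> nat) set \<Rightarrow> nat \<Rightarrow> nat set \<Rightarrow> bool" where
  "separated E i S \<longleftrightarrow> (\<forall>s\<in>S. \<forall>t\<in>S. s \<noteq> t \<longrightarrow> t \<notin> ball_of E i {s})"

lemma separated_subset: "separated E i S \<Longrightarrow> S' \<subseteq> S \<Longrightarrow> separated E i S'"
  unfolding separated_def by blast

text \<open>For \<open>s\<close> in \<open>P\<close> and \<open>i < r\<close>, the ball of radius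
  \<open>i\<close> around \<open>s\<close> meets \<open>P\<close> only in \<open>s\<close>, so some
  edge of \<open>J\<close> crosses its boundary. Edges chosen for different pairs
  \<open>(s, i)\<close> differ, which gives \<open>r * card P\<close> edges.\<close>

lemma card_crossing:
  assumes "finite P" "finite J" "J \<subseteq> E" "separated E (2 * r) P"
    and cross: "\<And>B. odd (card (P \<inter> B)) \<Longrightarrow> \<exists>(u, w)\<in>J. (u \<in> B) \<noteq> (w \<in> B)"
  shows "r * card P \<le> card J"
proof -
  define crosses where "crosses s i e \<longleftrightarrow> (fst e \<in> ball_of E i {s}) \<noteq> (snd e \<in> ball_of E i {s})"
    for s i and e :: "nat \<times> nat"
  have "\<exists>e\<in>J. crosses s i e" if "s \<in> P" "i < r" for s i
  proof -
    have "P \<inter> ball_of E i {s} = {s}"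
    proof -
      have "t \<notin> ball_of E i {s}" if "t \<in> P" "t \<noteq> s" for t
        using that \<open>s \<in> P\<close> assms(4) ball_of_mono_radius[of i "2 * r" E "{s}"] \<open>i < r\<close>
        by (auto simp: separated_def)
      then show ?thesis using \<open>s \<in> P\<close> subset_ball_of[of "{s}" E i] by auto
    qed
    then have "odd (card (P \<inter> ball_of E i {s}))" by simp
    from cross[OF this] show ?thesis unfolding crosses_def by fastforce
  qed
  then obtain f where f: "\<And>s i. s \<in> P \<Longrightarrow> i < r \<Longrightarrow> f (s, i) \<in> J \<and> crosses s i (f (s, i))"
    by (metis (no_types, lifting) case_prod_conv)
  have both: "fst e \<in> ball_of E (Suc i) {s} \<and> snd e \<in> ball_of E (Suc i) {s}"
    if "e \<in> J" "crosses s i e" for s i e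
  proof -
    have "(fst e, snd e) \<in> nbrs E" "(snd e, fst e) \<in> nbrs E"
      using that(1) assms(3) by (auto simp: nbrs_def)
    then show ?thesis using that(2) ball_of_Suc_mono[of E i "{s}"]
      unfolding crosses_def ball_of_Suc by blast
  qed
  have "inj_on f (P \<times> {..<r})"
  proof (rule inj_onI, clarify)
    fix s i t j assume *: "s \<in> P" "t \<in> P" "i < r" "j < r" and eq: "f (s, i) = f (t, j)"
    let ?e = "f (s, i)"
    have e: "?e \<in> J" "crosses s i ?e" "crosses t j ?e" using f * eq by metis+
    \<comment> \<open>A common edge has an end within \<open>j\<close> of \<open>t\<close> and both
      ends within \<open>i + 1\<close> of \<open>s\<close>; as \<open>i\<close> and \<open>j\<close>
      are below \<open>r\<close>, the two centres would be within \<open>2 * r\<close>.\<close>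
    have "s = t"
    proof (rule ccontr)
      assume "s \<noteq> t"
      obtain z where z: "z \<in> ball_of E j {t}" "z \<in> ball_of E (Suc i) {s}"
        using both[OF e(1,2)] e(3) unfolding crosses_def by blast
      then have "t \<in> ball_of E (Suc i + j) {s}"
        using ball_of_trans ball_of_sym by blast
      then have "t \<in> ball_of E (2 * r) {s}"
        using ball_of_mono_radius[of "Suc i + j" "2 * r" E "{s}"] * by auto
      then show False using assms(4) * \<open>s \<noteq> t\<close> by (auto simp: separated_def)
    qed
    \<comment> \<open>An edge crossing radius \<open>a\<close> lies entirely within radius
      \<open>a + 1\<close>, so it cannot cross a larger ball with the same centre.\<close>
    moreover have "\<not> a < b" if "crosses s a ?e" "crosses s b ?e" for a b
    proof
      assume "a < b"
      then have "ball_of E (Suc a) {s} \<subseteq> ball_of E b {s}"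
        by (intro ball_of_mono_radius) auto
      then show False using both[OF e(1) that(1)] that(2) unfolding crosses_def by blast
    qed
    ultimately show "s = t \<and> i = j" using e by (metis linorder_neqE_nat)
  qed
  moreover have "f ` (P \<times> {..<r}) \<subseteq> J" using f by auto
  ultimately have "card (P \<times> {..<r}) \<le> card J" using assms(2) by (intro card_inj_on_le)
  then show ?thesis by (simp add: card_cartesian_product mult.commute)
qed

text \<open>A subforest \<open>J\<close> with odd vertices \<open>P\<close> has at least
  \<open>r * card P\<close> edges, and each contributes a factor of at most
  \<open>l\<close>.\<close>

lemma avg_forest_separated:
  assumes "leafy n T" "\<forall>(u, w, a)\<in>set T. \<bar>a\<bar> \<le> l" "0 \<le> l" "l \<le> 1" "finite P" "P \<subseteq> {..<n}"
    and "separated (pairs_of T) (2 * r) P"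
  shows "\<bar>avg n (\<lambda>X. weight X T * (\<Prod>x\<in>P. spin X x))\<bar> \<le> (l ^ r) ^ card P"
proof -
  let ?E = "avg n (\<lambda>X. weight X T * (\<Prod>x\<in>P. spin X x))"
  consider "?E = 0" | J where "J \<subseteq> pairs_of T" "\<bar>?E\<bar> \<le> l ^ card J"
      "\<And>B. odd (card (P \<inter> B)) \<Longrightarrow> \<exists>(u, w)\<in>J. (u \<in> B) \<noteq> (w \<in> B)"
    using avg_forest_spins[OF assms(1-6)] by blast
  then show ?thesis
  proof cases
    case 1
    then show ?thesis using assms(3) by simp
  next
    case (2 J)
    then have "finite J" using finite_surj by blast
    then have "r * card P \<le> card J" using 2 assms by (intro card_crossing[of P J "pairs_of T"]) auto
    then have "l ^ card J \<le> l ^ (r * card P)" using assms by (intro power_decreasing) auto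
    then show ?thesis using 2 by (simp add: power_mult)
  qed
qed

text \<open>A list, so that \<open>distinct\<close> also excludes self-loops and chords sharing an
  endpoint.\<close>

fun ends :: "wedge list \<Rightarrow> nat list" where
  "ends [] = []"
| "ends ((u, w, a) # C) = u # w # ends C"

text \<open>Expanding the factor of one chord leaves a term without it and a term whose set
  \<open>P\<close> gains both endpoints; hence the induction over all \<open>P\<close>. Each chord
  taken costs \<open>l ^ (2 * r)\<close>, and summing over the nonempty sets of chords gives the
  binomial expression.\<close>

lemma avg_forest_chords:
  assumes "leafy n T" "\<forall>(u, w, a)\<in>set (T @ C). \<bar>a\<bar> \<le> l" "0 \<le> l" "l \<le> 1" "finite P"
    and "P \<union> set (ends C) \<subseteq> {..<n}" "separated (pairs_of T) (2 * r) (P \<union> set (ends C))"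
    and "distinct (ends C)" "P \<inter> set (ends C) = {}"
  shows "\<bar>avg n (\<lambda>X. weight X T * (\<Prod>x\<in>P. spin X x) * weight X C) -
          avg n (\<lambda>X. weight X T * (\<Prod>x\<in>P. spin X x))\<bar>
          \<le> (l ^ r) ^ card P * ((1 + l ^ (2 * r)) ^ length C - 1)"
  using assms(2,5-9)
proof (induction C arbitrary: P)
  case Nil
  then show ?case by simp
next
  case (Cons e C)
  obtain u v a where e: "e = (u, v, a)" by (cases e) auto
  let ?k = "l ^ r" and ?t = "l ^ (2 * r)"
  define F where "F P C = avg n (\<lambda>X. weight X T * (\<Prod>x\<in>P. spin X x) * weight X C)" for P C
  let ?Q = "insert u (insert v P)"
  have uv: "u \<noteq> v" "u \<notin> P" "v \<notin> P" "\<bar>a\<bar> \<le> l" using Cons.prems by (auto simp: e)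
  have cardQ: "card ?Q = card P + 2" using uv Cons.prems(2) by simp
  have k2: "?k ^ (card P + 2) = ?k ^ card P * ?t"
    by (simp add: power_add mult_2 power2_eq_square)
  have sub: "\<forall>(u, w, a)\<in>set (T @ C). \<bar>a\<bar> \<le> l" "distinct (ends C)"
    "P \<inter> set (ends C) = {}" "?Q \<inter> set (ends C) = {}"
    "P \<union> set (ends C) \<subseteq> {..<n}" "?Q \<union> set (ends C) \<subseteq> {..<n}"
    using Cons.prems by (auto simp: e)
  have sepQ: "separated (pairs_of T) (2 * r) (?Q \<union> set (ends C))"
    "separated (pairs_of T) (2 * r) (P \<union> set (ends C))" "separated (pairs_of T) (2 * r) ?Q"
    by (rule separated_subset[OF Cons.prems(4)]; auto simp: e)+
  have split: "F P (e # C) = F P C + a * F ?Q C"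
  proof -
    have "F P (e # C) = avg n (\<lambda>X. weight X T * (\<Prod>x\<in>P. spin X x) * weight X C +
              a * (weight X T * (\<Prod>x\<in>?Q. spin X x) * weight X C))"
      unfolding F_def using uv Cons.prems(2)
      by (intro avg_cong) (simp add: e algebra_simps)
    then show ?thesis unfolding avg_add avg_cmult F_def .
  qed
  have nil: "F P [] = avg n (\<lambda>X. weight X T * (\<Prod>x\<in>P. spin X x))" for P
    by (simp add: F_def)
  have 1: "\<bar>F P C - F P []\<bar> \<le> ?k ^ card P * ((1 + ?t) ^ length C - 1)"
    using Cons.IH[of P] sub sepQ Cons.prems(2) unfolding nil by (simp add: F_def)
  have 2: "\<bar>F ?Q C - F ?Q []\<bar> \<le> ?k ^ card ?Q * ((1 + ?t) ^ length C - 1)"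
    using Cons.IH[of ?Q] sub sepQ Cons.prems(2) unfolding nil by (simp add: F_def)
  have 3: "\<bar>F ?Q []\<bar> \<le> ?k ^ card ?Q"
    unfolding nil using sub sepQ Cons.prems(2) assms
    by (intro avg_forest_separated) auto
  have "\<bar>F ?Q C\<bar> \<le> ?k ^ card P * ?t * (1 + ?t) ^ length C"
    using 2 3 unfolding cardQ k2 by (simp add: algebra_simps)
  \<comment> \<open>The chord's own weight is only bounded by 1; the decay comes from the forest
    edges.\<close>
  then have "\<bar>a * F ?Q C\<bar> \<le> 1 * (?k ^ card P * ?t * (1 + ?t) ^ length C)"
    unfolding abs_mult using uv assms(4) by (intro mult_mono) auto
  then have "\<bar>F P (e # C) - F P []\<bar> \<le>
      ?k ^ card P * ((1 + ?t) ^ length C - 1) + ?k ^ card P * ?t * (1 + ?t) ^ length C"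
    unfolding split using 1 by linarith
  also have "\<dots> = ?k ^ card P * ((1 + ?t) ^ length (e # C) - 1)"
    by (simp add: algebra_simps)
  finally show ?case unfolding nil by (simp add: F_def)
qed

text \<open>The case \<open>P = {}\<close>, where the average without chords is 1. The lower bound
  is what limits the excess of YES over NO probability.\<close>

lemma avg_forest_chords_ge:
  assumes "leafy n T" "\<forall>(u, w, a)\<in>set (T @ C). \<bar>a\<bar> \<le> l" "0 \<le> l" "l \<le> 1"
    and "set (ends C) \<subseteq> {..<n}" "separated (pairs_of T) (2 * r) (set (ends C))"
    and "distinct (ends C)"
  shows "avg n (\<lambda>X. weight X T * weight X C) \<ge> 2 - (1 + l ^ (2 * r)) ^ length C"
  using avg_forest_chords[OF assms(1-4), where P = "{}" and r = r] assms(5-7)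
    avg_forest_weight[OF assms(1)] by simp

section \<open>Partial explorations\<close>

text \<open>Half-edge, partner and label; lists of reveals have the most recent one at the head.\<close>
type_synonym reveal = "nat \<times> nat \<times> bool"

definition seen :: "nat \<Rightarrow> reveal list \<Rightarrow> nat set" where
  "seen d \<sigma> = (\<Union>(h, h', y)\<in>set \<sigma>. {h div d, h' div d})"

definition matched :: "reveal list \<Rightarrow> nat set" where
  "matched \<sigma> = (\<Union>(h, h', y)\<in>set \<sigma>. {h, h'})"

fun valid :: "nat \<Rightarrow> reveal list \<Rightarrow> bool" where
  "valid N [] = True"
| "valid N ((h, h', y) # \<sigma>) \<longleftrightarrow> valid N \<sigma> \<and> h < N \<and> h' < N \<and> h \<noteq> h' \<and>
     h \<notin> matched \<sigma> \<and> h' \<notin> matched \<sigma>"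

text \<open>The vertex of \<open>h\<close> is inserted so that a self-loop at a fresh vertex also
  collides.\<close>

definition collides :: "nat \<Rightarrow> reveal list \<Rightarrow> nat \<Rightarrow> nat \<Rightarrow> bool" where
  "collides d \<sigma> h h' \<longleftrightarrow> h' div d \<in> insert (h div d) (seen d \<sigma>)"

definition wedge_of :: "nat \<Rightarrow> real \<Rightarrow> reveal \<Rightarrow> wedge" where
  "wedge_of d l = (\<lambda>(h, h', y). (h div d, h' div d, if y then - l else l))"

fun forest :: "nat \<Rightarrow> real \<Rightarrow> reveal list \<Rightarrow> wedge list" where
  "forest d l [] = []"
| "forest d l ((h, h', y) # \<sigma>) =
     (if collides d \<sigma> h h' then forest d l \<sigma> else wedge_of d l (h, h', y) # forest d l \<sigma>)"

fun chords :: "nat \<Rightarrow> real \<Rightarrow> reveal list \<Rightarrow> wedge list" where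
  "chords d l [] = []"
| "chords d l ((h, h', y) # \<sigma>) =
     (if collides d \<sigma> h h' then wedge_of d l (h, h', y) # chords d l \<sigma> else chords d l \<sigma>)"

text \<open>The weight parameter 0 is a dummy: edges and chord ends do not depend on it.\<close>

definition fedges :: "nat \<Rightarrow> reveal list \<Rightarrow> (nat \<times> nat) set" where
  "fedges d \<sigma> = pairs_of (forest d 0 \<sigma>)"

definition chord_ends :: "nat \<Rightarrow> reveal list \<Rightarrow> nat set" where
  "chord_ends d \<sigma> = set (ends (chords d 0 \<sigma>))"

definition near :: "nat \<Rightarrow> nat \<Rightarrow> reveal list \<Rightarrow> nat set" where
  "near d r \<sigma> = ball_of (fedges d \<sigma>) (2 * r) (chord_ends d \<sigma>)"

text \<open>A collision after which the chord ends need not be pairwise further than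
  \<open>2 * r\<close> apart. The first alternative depends on the half-edge that the algorithm
  chose, the second on the random partner; they are charged differently.\<close>

definition bad_step :: "nat \<Rightarrow> nat \<Rightarrow> reveal list \<Rightarrow> nat \<Rightarrow> nat \<Rightarrow> bool" where
  "bad_step d r \<sigma> h h' \<longleftrightarrow> collides d \<sigma> h h' \<and> (h div d \<in> near d r \<sigma> \<or>
     h' div d \<in> ball_of (fedges d \<sigma>) (2 * r) (insert (h div d) (chord_ends d \<sigma>)))"

fun good :: "nat \<Rightarrow> nat \<Rightarrow> reveal list \<Rightarrow> bool" where
  "good d r [] = True"
| "good d r ((h, h', y) # \<sigma>) \<longleftrightarrow> good d r \<sigma> \<and> \<not> bad_step d r \<sigma> h h'"

text \<open>The algorithm may deliberately explore near earlier collisions; this set records how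
  often it does.\<close>

fun near_reveals :: "nat \<Rightarrow> nat \<Rightarrow> reveal list \<Rightarrow> nat set" where
  "near_reveals d r [] = {}"
| "near_reveals d r ((h, h', y) # \<sigma>) =
     (if h div d \<in> near d r \<sigma> then insert h (near_reveals d r \<sigma>) else near_reveals d r \<sigma>)"

definition matches :: "(nat \<Rightarrow> nat) \<Rightarrow> reveal list \<Rightarrow> bool" where
  "matches p \<sigma> \<longleftrightarrow> (\<forall>(h, h', y)\<in>set \<sigma>. p h = h' \<and> p h' = h)"

section \<open>Basic facts about explorations\<close>

lemma seen_Nil [simp]: "seen d [] = {}"
  and seen_Cons [simp]: "seen d ((h, h', y) # \<sigma>) = insert (h div d) (insert (h' div d) (seen d \<sigma>))"
  by (auto simp: seen_def)

lemma matched_Nil [simp]: "matched [] = {}"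
  and matched_Cons [simp]: "matched ((h, h', y) # \<sigma>) = insert h (insert h' (matched \<sigma>))"
  by (auto simp: matched_def)

lemma fedges_Nil [simp]: "fedges d [] = {}"
  and fedges_Cons [simp]: "fedges d ((h, h', y) # \<sigma>) =
    (if collides d \<sigma> h h' then fedges d \<sigma> else insert (h div d, h' div d) (fedges d \<sigma>))"
  by (simp_all add: fedges_def wedge_of_def)

lemma chord_ends_Nil [simp]: "chord_ends d [] = {}"
  and chord_ends_Cons [simp]: "chord_ends d ((h, h', y) # \<sigma>) =
    (if collides d \<sigma> h h' then insert (h div d) (insert (h' div d) (chord_ends d \<sigma>))
     else chord_ends d \<sigma>)"
  by (simp_all add: chord_ends_def wedge_of_def)

lemma pairs_of_forest: "pairs_of (forest d l \<sigma>) = fedges d \<sigma>"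
  by (induction d l \<sigma> rule: forest.induct) (auto simp: wedge_of_def)

lemma ends_chords: "ends (chords d l \<sigma>) = ends (chords d 0 \<sigma>)"
  by (induction d l \<sigma> rule: chords.induct) (auto simp: wedge_of_def)

lemma length_chords: "length (chords d l \<sigma>) = length (chords d 0 \<sigma>)"
  by (induction d l \<sigma> rule: chords.induct) auto

lemma matched_less: "valid N \<sigma> \<Longrightarrow> matched \<sigma> \<subseteq> {..<N}"
  by (induction N \<sigma> rule: valid.induct) auto

lemma finite_matched [simp]: "finite (matched \<sigma>)"
  by (auto simp: matched_def)

lemma finite_seen [simp]: "finite (seen d \<sigma>)"
  by (auto simp: seen_def)

lemma card_matched: "valid N \<sigma> \<Longrightarrow> card (matched \<sigma>) = 2 * length \<sigma>"
  by (induction N \<sigma> rule: valid.induct) auto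

lemma card_seen_le: "card (seen d \<sigma>) \<le> 2 * length \<sigma>"
proof (induction \<sigma>)
  case (Cons e \<sigma>)
  obtain h h' y where "e = (h, h', y)" by (cases e) auto
  then show ?case using Cons by (simp add: card_insert_if)
qed simp

lemma seen_less: "valid (n * d) \<sigma> \<Longrightarrow> seen d \<sigma> \<subseteq> {..<n}"
  by (induction "n * d" \<sigma> rule: valid.induct) (auto simp: less_mult_imp_div_less)

lemma fedges_seen: "Field (fedges d \<sigma>) \<subseteq> seen d \<sigma>"
  by (induction d "0::real" \<sigma> rule: forest.induct) auto

lemma finite_fedges [simp]: "finite (fedges d \<sigma>)"
  by (simp add: fedges_def)

lemma chord_ends_seen: "chord_ends d \<sigma> \<subseteq> seen d \<sigma>"
  by (induction d "0::real" \<sigma> rule: forest.induct) auto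

lemma card_ends_le: "card (set (ends C)) \<le> 2 * length C"
  by (induction C rule: ends.induct) (auto simp: card_insert_if)

lemma card_chord_ends_le: "card (chord_ends d \<sigma>) \<le> 2 * length (chords d 0 \<sigma>)"
  unfolding chord_ends_def by (rule card_ends_le)

lemma finite_chord_ends [simp]: "finite (chord_ends d \<sigma>)"
  by (simp add: chord_ends_def)

text \<open>The partner vertex of a reveal without collision is unseen, hence incident to no earlier
  forest edge.\<close>

lemma leafy_forest: "valid (n * d) \<sigma> \<Longrightarrow> leafy n (forest d l \<sigma>)"
proof (induction \<sigma>)
  case (Cons e \<sigma>)
  obtain h h' y where e: "e = (h, h', y)" by (cases e) auto
  have "\<forall>(x, y, b)\<in>set (forest d l \<sigma>). x \<in> seen d \<sigma> \<and> y \<in> seen d \<sigma>"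
    using fedges_seen[of d \<sigma>] unfolding pairs_of_forest[of d l, symmetric] Field_def by force
  then have "\<forall>(x, y, b)\<in>set (forest d l \<sigma>). v \<noteq> x \<and> v \<noteq> y" if "v \<notin> seen d \<sigma>" for v
    using that by blast
  then show ?case using Cons
    by (simp add: e collides_def wedge_of_def less_mult_imp_div_less)
qed simp

lemma abs_weights:
  "0 \<le> l \<Longrightarrow> \<forall>(u, w, a)\<in>set (forest d l \<sigma> @ chords d l \<sigma>). \<bar>a\<bar> \<le> l"
  by (induction d l \<sigma> rule: forest.induct) (auto simp: wedge_of_def)

lemma separated_insert:
  assumes "separated E i S" "x \<notin> ball_of E i S"
  shows "separated E i (insert x S)"
proof -
  have "x \<notin> ball_of E i {s}" "s \<notin> ball_of E i {x}" if "s \<in> S" for s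
    using assms(2) that ball_of_Union[of E i S] ball_of_sym[of x E i s] by blast+
  then show ?thesis using assms(1) unfolding separated_def by blast
qed

text \<open>A collision that is not a bad step has its ends far from each other and from older ends.
  A forest edge only hangs on a new leaf, which does not shorten distances between old
  vertices.\<close>

lemma good_separated:
  assumes "valid (n * d) \<sigma>" "good d r \<sigma>"
  shows "separated (fedges d \<sigma>) (2 * r) (chord_ends d \<sigma>) \<and> distinct (ends (chords d 0 \<sigma>))"
  using assms
proof (induction \<sigma>)
  case Nil
  then show ?case by (simp add: separated_def)
next
  case (Cons e \<sigma>)
  obtain h h' y where e: "e = (h, h', y)" by (cases e) auto
  let ?u = "h div d" and ?v = "h' div d" and ?E = "fedges d \<sigma>" and ?S = "chord_ends d \<sigma>"
  have IH: "separated ?E (2 * r) ?S" "distinct (ends (chords d 0 \<sigma>))"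
    using Cons by (auto simp: e)
  show ?case
  proof (cases "collides d \<sigma> h h'")
    case True
    then have uv: "?u \<notin> ball_of ?E (2 * r) ?S" "?v \<notin> ball_of ?E (2 * r) (insert ?u ?S)"
      using Cons.prems by (auto simp: e bad_step_def near_def)
    have "separated ?E (2 * r) (insert ?v (insert ?u ?S))"
      by (intro separated_insert IH uv)
    moreover have "?u \<notin> ?S" "?v \<notin> insert ?u ?S"
      using uv subset_ball_of by blast+
    ultimately show ?thesis using IH True
      by (auto simp: e wedge_of_def insert_commute chord_ends_def)
  next
    case False
    then have v: "?v \<notin> seen d \<sigma>" "?u \<noteq> ?v" by (auto simp: collides_def)
    have "separated (insert (?u, ?v) ?E) (2 * r) ?S"
      unfolding separated_def
    proof (intro ballI impI notI)
      fix s t assume *: "s \<in> ?S" "t \<in> ?S" "s \<noteq> t" "t \<in> ball_of (insert (?u, ?v) ?E) (2 * r) {s}"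
      have "s \<noteq> ?v" "t \<noteq> ?v" "?v \<notin> Field ?E"
        using * v chord_ends_seen fedges_seen by blast+
      then have "t \<in> ball_of ?E (2 * r) {s}"
        using ball_of_insert_leaf[of ?v ?E ?u s t "2 * r"] *(4) v(2) by auto
      then show False using IH(1) * by (auto simp: separated_def)
    qed
    then show ?thesis using IH False by (simp add: e)
  qed
qed

text \<open>The probability of the revealed labels in the NO case given the pairing, divided by that
  under uniform labels; see \<open>prob_no_labels\<close>.\<close>

definition likelihood :: "nat \<Rightarrow> nat \<Rightarrow> real \<Rightarrow> reveal list \<Rightarrow> real" where
  "likelihood n d l \<sigma> = avg n (\<lambda>X. weight X (map (wedge_of d l) \<sigma>))"

lemma weight_split:
  "weight X (map (wedge_of d l) \<sigma>) = weight X (forest d l \<sigma>) * weight X (chords d l \<sigma>)"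
  by (induction d l \<sigma> rule: forest.induct) (auto simp: wedge_of_def)

lemma likelihood_ge:
  assumes "valid (n * d) \<sigma>" "good d r \<sigma>" "0 \<le> l" "l \<le> 1" "length (chords d 0 \<sigma>) \<le> R"
  shows "likelihood n d l \<sigma> \<ge> 2 - (1 + l ^ (2 * r)) ^ R"
proof -
  have "set (ends (chords d l \<sigma>)) \<subseteq> {..<n}"
    using chord_ends_seen[of d \<sigma>] seen_less[OF assms(1)] unfolding ends_chords[of d l] chord_ends_def by blast
  then have "likelihood n d l \<sigma> \<ge> 2 - (1 + l ^ (2 * r)) ^ length (chords d l \<sigma>)"
    unfolding likelihood_def weight_split
    using good_separated[OF assms(1,2)] abs_weights[OF assms(3)] leafy_forest[OF assms(1)] assms(3,4)
    by (intro avg_forest_chords_ge) (auto simp: pairs_of_forest ends_chords[of d l] chord_ends_def)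
  moreover have "(1 + l ^ (2 * r)) ^ length (chords d l \<sigma>) \<le> (1 + l ^ (2 * r)) ^ R"
    using assms by (intro power_increasing) (auto simp: length_chords[of d l])
  ultimately show ?thesis by linarith
qed

section \<open>Sizes of balls around collisions\<close>

lemma card_halfedges:
  assumes "d > 0" "finite (B :: nat set)"
  shows "finite {h. h div d \<in> B} \<and> card {h. h div d \<in> B} = d * card B"
  using assms(2)
proof (induction B rule: finite_induct)
  case (insert b B)
  have "h div d = b \<longleftrightarrow> h \<in> {b * d..<b * d + d}" for h
  proof
    assume "h div d = b"
    then show "h \<in> {b * d..<b * d + d}"
      using dividend_less_times_div[OF assms(1), of h] times_div_less_eq_dividend[of d h]
      by (simp add: mult.commute add.commute)
  next
    assume "h \<in> {b * d..<b * d + d}"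
    then show "h div d = b" by (intro div_nat_eqI) (auto simp: mult.commute)
  qed
  then have 1: "{h. h div d = b} = {b * d..<b * d + d}" by blast
  have "{h. h div d \<in> insert b B} = {h. h div d = b} \<union> {h. h div d \<in> B}" by auto
  moreover have "{h. h div d = b} \<inter> {h. h div d \<in> B} = {}" using insert by auto
  ultimately show ?case using insert 1 by (simp add: card_Un_disjoint)
qed simp

lemma matches_Cons [simp]: "matches p ((h, h', y) # \<sigma>) \<longleftrightarrow> p h = h' \<and> p h' = h \<and> matches p \<sigma>"
  by (auto simp: matches_def)

text \<open>Realises forest edges by half-edges of a pairing, which limits the forest degrees to
  \<open>d\<close>.\<close>

lemma fedges_matches:
  assumes "matches p \<sigma>" "(x, y) \<in> fedges d \<sigma>"
  shows "\<exists>h. h div d = x \<and> p h div d = y \<and> p (p h) = h"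
  using assms
proof (induction \<sigma>)
  case (Cons e \<sigma>)
  obtain h h' c where "e = (h, h', c)" by (cases e) auto
  then show ?case using Cons by (auto split: if_splits)
qed simp

text \<open>A vertex has \<open>d\<close> half-edges, so each step outward multiplies the size by at
  most \<open>d + 1\<close>.\<close>

lemma card_ball_of_le:
  assumes "matches p \<sigma>" "d > 0" "finite S"
  shows "card (ball_of (fedges d \<sigma>) i S) \<le> (d + 1) ^ i * card S"
proof (induction i)
  case (Suc i)
  let ?B = "ball_of (fedges d \<sigma>) i S"
  have fin: "finite ?B" using assms by (intro finite_ball_of) auto
  have H: "finite {h. h div d \<in> ?B}" "card {h. h div d \<in> ?B} = d * card ?B"
    using card_halfedges[OF assms(2) fin] by auto
  have "nbrs (fedges d \<sigma>) `` ?B \<subseteq> ?B \<union> (\<lambda>h. p h div d) ` {h. h div d \<in> ?B}"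
  proof
    fix y assume "y \<in> nbrs (fedges d \<sigma>) `` ?B"
    then obtain x where x: "x \<in> ?B" "(x, y) \<in> nbrs (fedges d \<sigma>)" by auto
    consider "x = y" | "(x, y) \<in> fedges d \<sigma>" | "(y, x) \<in> fedges d \<sigma>"
      using x(2) by (auto simp: nbrs_def)
    then show "y \<in> ?B \<union> (\<lambda>h. p h div d) ` {h. h div d \<in> ?B}"
    proof cases
      \<comment> \<open>For an edge in the opposite direction, the half-edge at \<open>x\<close> is
        \<open>p h\<close>.\<close>
      case 3
      from fedges_matches[OF assms(1) this] obtain h where "h div d = y" "p h div d = x" "p (p h) = h"
        by blast
      then show ?thesis using x by (auto intro!: image_eqI[of _ _ "p h"])
    qed (use x fedges_matches[OF assms(1), of x y d] in auto)
  qed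
  then have "card (ball_of (fedges d \<sigma>) (Suc i) S) \<le> card (?B \<union> (\<lambda>h. p h div d) ` {h. h div d \<in> ?B})"
    unfolding ball_of_Suc using fin H by (intro card_mono) auto
  also have "\<dots> \<le> card ?B + d * card ?B"
    by (rule order_trans[OF card_Un_le], rule add_left_mono, subst H(2)[symmetric],
        rule card_image_le[OF H(1)])
  also have "\<dots> = (d + 1) * card ?B" by simp
  also have "\<dots> \<le> (d + 1) * ((d + 1) ^ i * card S)" using Suc by (intro mult_left_mono) auto
  also have "\<dots> = (d + 1) ^ Suc i * card S" by (simp add: algebra_simps)
  finally show ?case .
qed simp

lemma finite_near [simp]: "finite (near d r \<sigma>)"
  unfolding near_def by (intro finite_ball_of) auto

lemma near_Cons: "near d r \<sigma> \<subseteq> near d r (e # \<sigma>)"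
  unfolding near_def by (cases e, intro ball_of_mono) auto

text \<open>\<open>near\<close> only grows along an exploration, so a half-edge counted earlier is
  still near.\<close>

lemma near_reveals_subset: "near_reveals d r \<sigma> \<subseteq> {h. h div d \<in> near d r \<sigma>} \<inter> matched \<sigma>"
proof (induction \<sigma>)
  case (Cons e \<sigma>)
  then show ?case using near_Cons[of d r \<sigma> e] by (cases e) auto
qed simp

text \<open>All these half-edges sit at vertices of the current balls, so the bound involves the
  collisions but not the number of reveals.\<close>

lemma card_near_reveals_le:
  assumes "matches p \<sigma>" "d > 0"
  shows "card (near_reveals d r \<sigma>) \<le> 2 * d * (d + 1) ^ (2 * r) * length (chords d 0 \<sigma>)"
proof -
  have "card (near_reveals d r \<sigma>) \<le> card {h. h div d \<in> near d r \<sigma>}"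
    using near_reveals_subset[of d r \<sigma>] card_halfedges[OF assms(2), of "near d r \<sigma>"]
    by (intro card_mono) simp_all
  also have "\<dots> = d * card (near d r \<sigma>)" using card_halfedges[OF assms(2), of "near d r \<sigma>"] by simp
  also have "\<dots> \<le> d * ((d + 1) ^ (2 * r) * card (chord_ends d \<sigma>))"
    unfolding near_def by (intro mult_left_mono card_ball_of_le[OF assms]) auto
  also have "\<dots> \<le> d * ((d + 1) ^ (2 * r) * (2 * length (chords d 0 \<sigma>)))"
    by (intro mult_left_mono card_chord_ends_le) auto
  finally show ?thesis by (simp add: mult_ac)
qed

lemma card_near_reveals_Cons:
  assumes "h \<notin> matched \<sigma>"
  shows "card (near_reveals d r ((h, h', y) # \<sigma>)) =
    card (near_reveals d r \<sigma>) + (if h div d \<in> near d r \<sigma> then 1 else 0)"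
proof -
  have "finite (near_reveals d r \<sigma>)" "h \<notin> near_reveals d r \<sigma>"
    using near_reveals_subset[of d r \<sigma>] assms finite_matched[of \<sigma>] by (auto intro: finite_subset)
  then show ?thesis by simp
qed

section \<open>Probabilities of partial explorations\<close>

definition yes_inst :: "nat \<Rightarrow> nat \<Rightarrow> np_instance pmf" where
  "yes_inst n d = do {p \<leftarrow> pmf_of_set (pairings n d); Y \<leftarrow> yes_labels n d p; return_pmf (p, Y)}"

definition no_inst :: "nat \<Rightarrow> nat \<Rightarrow> real \<Rightarrow> np_instance pmf" where
  "no_inst n d \<epsilon> = do {p \<leftarrow> pmf_of_set (pairings n d); Y \<leftarrow> no_labels n d \<epsilon> p; return_pmf (p, Y)}"

lemma prob_bind_pmf:
  "measure_pmf.prob (bind_pmf M f) A = (\<integral>x. measure_pmf.prob (f x) A \<partial>measure_pmf M)"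
proof -
  have "ennreal (measure_pmf.prob (bind_pmf M f) A) = (\<integral>\<^sup>+x. ennreal (measure_pmf.prob (f x) A) \<partial>measure_pmf M)"
    using emeasure_bind_pmf[of M f A] by (simp add: measure_pmf.emeasure_eq_measure)
  also have "\<dots> = ennreal (\<integral>x. measure_pmf.prob (f x) A \<partial>measure_pmf M)"
    by (intro nn_integral_eq_integral measure_pmf.integrable_const_bound[where B = 1]) auto
  finally show ?thesis by (simp add: integral_nonneg_AE)
qed

lemma prob_bind_pmf_of_set:
  assumes "finite S" "S \<noteq> {}"
  shows "measure_pmf.prob (bind_pmf (pmf_of_set S) f) A = (\<Sum>x\<in>S. measure_pmf.prob (f x) A) / card S"
  unfolding prob_bind_pmf using assms by (simp add: integral_pmf_of_set)

lemma finite_pairings [simp]: "finite (pairings n d)"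
proof (rule finite_subset)
  show "pairings n d \<subseteq> (\<lambda>g h. if h < n * d then g h else h) ` ({..<n * d} \<rightarrow>\<^sub>E {..<n * d})"
  proof
    fix p assume "p \<in> pairings n d"
    then show "p \<in> (\<lambda>g h. if h < n * d then g h else h) ` ({..<n * d} \<rightarrow>\<^sub>E {..<n * d})"
      by (intro image_eqI[of _ _ "restrict p {..<n * d}"]) (auto simp: pairings_def)
  qed
qed (auto intro: finite_PiE)

lemma pairings_nonempty:
  assumes "even (n * d)"
  shows "pairings n d \<noteq> {}"
proof -
  \<comment> \<open>Pairs \<open>2 * i\<close> with \<open>2 * i + 1\<close>.\<close>
  define p where "p h = (if n * d \<le> h then h else if even h then h + 1 else h - 1)" for h
  have "p h < n * d \<and> p h \<noteq> h \<and> p (p h) = h" if "h < n * d" for h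
  proof (cases "even h")
    case True
    then have "h + 1 < n * d" using that assms by (metis Suc_eq_plus1 Suc_lessI even_Suc)
    then show ?thesis using True by (auto simp: p_def)
  next
    case False
    then show ?thesis using that by (auto simp: p_def elim!: oddE)
  qed
  then have "p \<in> pairings n d" by (auto simp: pairings_def p_def)
  then show ?thesis by blast
qed

lemma success_prob_eq:
  "success_prob n d \<epsilon> k A =
     1/2 * measure_pmf.prob (yes_inst n d) {I. exec d A I k [] = Some True} +
     1/2 * measure_pmf.prob (no_inst n d \<epsilon>) {I. exec d A I k [] = Some False}"
proof -
  let ?S = "{(yes, I). exec d A I k [] = Some yes}"
  have "noisy_parities n d \<epsilon> =
    bind_pmf coin (\<lambda>yes. map_pmf (Pair yes) (if yes then yes_inst n d else no_inst n d \<epsilon>))"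
    unfolding noisy_parities_def
    \<comment> \<open>The coin is drawn before the pairing.\<close>
    by (subst bind_commute_pmf, intro bind_pmf_cong refl)
       (auto simp: yes_inst_def no_inst_def map_bind_pmf)
  moreover have "Pair yes -` ?S = {I. exec d A I k [] = Some yes}" for yes by auto
  ultimately show ?thesis
    unfolding success_prob_def by (simp add: prob_bind_pmf coin_def)
qed

section \<open>Events fixed by a partial exploration\<close>

definition extending :: "reveal list \<Rightarrow> np_instance set" where
  "extending \<sigma> = {(p, Y). matches p \<sigma> \<and> (\<forall>(h, h', y)\<in>set \<sigma>. Y h = y \<and> Y h' = y)}"

text \<open>Constraints that hold almost surely in both cases. The values beyond
  \<open>n * d\<close> fix the answer to a query of a number that is not a vertex.\<close>

definition consistent :: "nat \<Rightarrow> nat \<Rightarrow> np_instance set" where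
  "consistent n d = {(p, Y). p \<in> pairings n d \<and> (\<forall>h. Y (p h) = Y h) \<and> (\<forall>h\<ge>n * d. \<not> Y h)}"

definition matching :: "nat \<Rightarrow> nat \<Rightarrow> reveal list \<Rightarrow> (nat \<Rightarrow> nat) set" where
  "matching n d \<sigma> = {p \<in> pairings n d. matches p \<sigma>}"

lemma pairings_involution: "p \<in> pairings n d \<Longrightarrow> p (p h) = h"
  by (cases "h < n * d") (auto simp: pairings_def)

lemma set_yes_inst:
  assumes "even (n * d)"
  shows "set_pmf (yes_inst n d) \<subseteq> consistent n d"
proof -
  have "Y (p h) = Y h \<and> (n * d \<le> h \<longrightarrow> \<not> Y h)"
    if "p \<in> pairings n d" "Y \<in> set_pmf (yes_labels n d p)" for p Y h
  proof -
    from that obtain c where c: "c \<in> set_pmf (Pi_pmf {..<n * d} False (\<lambda>_. coin))"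
      "Y = (\<lambda>h. c (min h (p h)))" by (auto simp: yes_labels_def)
    have "\<not> c h" if "n * d \<le> h" for h using c(1) set_Pi_pmf_subset[of "{..<n * d}" False "\<lambda>_. coin"] that by auto
    then show ?thesis using c pairings_involution[OF that(1)] that(1) by (auto simp: min.commute pairings_def)
  qed
  then show ?thesis using pairings_nonempty[OF assms] by (auto simp: yes_inst_def consistent_def)
qed

lemma set_no_inst:
  assumes "even (n * d)"
  shows "set_pmf (no_inst n d \<epsilon>) \<subseteq> consistent n d"
proof -
  have "Y (p h) = Y h \<and> (n * d \<le> h \<longrightarrow> \<not> Y h)"
    if p: "p \<in> pairings n d" and "Y \<in> set_pmf (no_labels n d \<epsilon> p)" for p Y h
  proof -
    define F where "F X Z h \<longleftrightarrow> (X (h div d) \<noteq> X (p h div d)) \<noteq> Z (min h (p h))"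
      for X Z :: "nat \<Rightarrow> bool" and h
    have "no_labels n d \<epsilon> p = do { X \<leftarrow> Pi_pmf {..<n} False (\<lambda>_. coin);
        Z \<leftarrow> Pi_pmf {..<n * d} False (\<lambda>_. bernoulli_pmf \<epsilon>); return_pmf (F X Z) }"
      by (simp add: no_labels_def F_def[abs_def])
    with that obtain X Z where XZ: "Z \<in> set_pmf (Pi_pmf {..<n * d} False (\<lambda>_. bernoulli_pmf \<epsilon>))"
      "Y = F X Z" by auto
    have "\<not> Z h" if "n * d \<le> h" for h
      using XZ(1) set_Pi_pmf_subset[of "{..<n * d}" False "\<lambda>_. bernoulli_pmf \<epsilon>"] that by auto
    then show ?thesis
      unfolding XZ(2) F_def using pairings_involution[OF p] p by (auto simp: min.commute pairings_def)
  qed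
  then show ?thesis using pairings_nonempty[OF assms] by (auto simp: no_inst_def consistent_def)
qed

lemma prob_Pi_pmf_cylinder:
  assumes "finite A" "distinct (map fst L)" "fst ` set L \<subseteq> A"
  shows "measure_pmf.prob (Pi_pmf A dflt P) {c. \<forall>(k, v)\<in>set L. c k = v} =
    (\<Prod>(k, v)\<leftarrow>L. pmf (P k) v)"
proof -
  define B where "B k = {v. \<forall>v'. (k, v') \<in> set L \<longrightarrow> v = v'}" for k
  have "{c. \<forall>(k, v)\<in>set L. c k = v} = Pi A B"
    using assms(3) by (force simp: B_def Pi_def)
  then have "measure_pmf.prob (Pi_pmf A dflt P) {c. \<forall>(k, v)\<in>set L. c k = v} =
      (\<Prod>k\<in>A. measure_pmf.prob (P k) (B k))"
    using measure_Pi_pmf_Pi[OF assms(1)] by metis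
  also have "\<dots> = (\<Prod>k\<in>fst ` set L. measure_pmf.prob (P k) (B k))"
  proof (intro prod.mono_neutral_right assms ballI)
    fix k assume "k \<in> A - fst ` set L"
    then have "B k = UNIV" by (force simp: B_def)
    then show "measure_pmf.prob (P k) (B k) = 1" by simp
  qed
  also have "\<dots> = (\<Prod>k\<leftarrow>map fst L. measure_pmf.prob (P k) (B k))"
    using prod.distinct_set_conv_list[OF assms(2)] by simp
  also have "\<dots> = (\<Prod>(k, v)\<leftarrow>L. pmf (P k) v)"
  proof -
    have "B k = {v}" if "(k, v) \<in> set L" for k v
      using that eq_key_imp_eq_value[OF assms(2)] by (auto simp: B_def)
    then show ?thesis
      unfolding map_map by (intro arg_cong[where f = prod_list] map_cong) (auto simp: measure_pmf_single)
  qed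
  finally show ?thesis .
qed

lemma min_in_matched: "(h, h', y) \<in> set \<sigma> \<Longrightarrow> min h h' \<in> matched \<sigma>"
  by (auto simp: matched_def min_def)

text \<open>\<open>min h h'\<close> is matched by one reveal only, so distinct reveals read
  independent label coordinates.\<close>

lemma distinct_representatives: "valid N \<sigma> \<Longrightarrow> distinct (map (\<lambda>(h, h', y). min h h') \<sigma>)"
proof (induction \<sigma>)
  case (Cons e \<sigma>)
  obtain h h' y where e: "e = (h, h', y)" by (cases e) auto
  have "min h h' \<notin> matched \<sigma>" using Cons.prems by (simp add: e min_def)
  then show ?case using Cons min_in_matched[of _ _ _ \<sigma>] by (auto simp: e)
qed simp

lemma prob_cylinder:
  assumes "valid N \<sigma>"
  shows "measure_pmf.prob (Pi_pmf {..<N} False (\<lambda>_. P)) {c. \<forall>(h, h', y)\<in>set \<sigma>. c (min h h') = f h h' y} =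
    (\<Prod>(h, h', y)\<leftarrow>\<sigma>. pmf P (f h h' y))"
proof -
  let ?L = "map (\<lambda>(h, h', y). (min h h', f h h' y)) \<sigma>"
  have "distinct (map fst ?L)"
    using distinct_representatives[OF assms] by (simp add: comp_def case_prod_unfold)
  moreover have "fst ` set ?L \<subseteq> {..<N}"
    using min_in_matched[of _ _ _ \<sigma>] matched_less[OF assms] by fastforce
  ultimately have "measure_pmf.prob (Pi_pmf {..<N} False (\<lambda>_. P)) {c. \<forall>(k, v)\<in>set ?L. c k = v} =
      (\<Prod>(k, v)\<leftarrow>?L. pmf P v)"
    by (intro prob_Pi_pmf_cylinder) auto
  then show ?thesis by (simp add: comp_def case_prod_unfold)
qed

lemma matches_in: "matches p \<sigma> \<Longrightarrow> (h, h', y) \<in> set \<sigma> \<Longrightarrow> p h = h' \<and> p h' = h"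
  by (auto simp: matches_def)

lemma prob_yes_labels:
  assumes "valid (n * d) \<sigma>" "matches p \<sigma>"
  shows "measure_pmf.prob (yes_labels n d p) {Y. (p, Y) \<in> extending \<sigma>} = (1/2) ^ length \<sigma>"
proof -
  have "{c. (p, \<lambda>h. c (min h (p h))) \<in> extending \<sigma>} = {c. \<forall>(h, h', y)\<in>set \<sigma>. c (min h h') = y}"
    using assms(2) matches_in[OF assms(2)] unfolding extending_def
    by (auto simp: min.commute)
  then have "measure_pmf.prob (yes_labels n d p) {Y. (p, Y) \<in> extending \<sigma>} =
      (\<Prod>(h, h', y)\<leftarrow>\<sigma>. pmf coin y)"
    using prob_cylinder[OF assms(1), of coin "\<lambda>h h' y. y"] by (simp add: yes_labels_def vimage_def)
  also have "\<dots> = (1/2) ^ length \<sigma>" by (induction \<sigma>) (auto simp: coin_def)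
  finally show ?thesis .
qed

lemma spins_pmf: "Pi_pmf {..<n} False (\<lambda>_. coin) = pmf_of_set (configs n)"
  unfolding configs_def coin_def bernoulli_pmf_half_conv_pmf_of_set by (intro Pi_pmf_of_set) auto

lemma configs_nonempty: "configs n \<noteq> {}"
  using card_configs[of n] by auto

text \<open>Given the bits \<open>X\<close>, a revealed label forces the noise bit of its edge to
  \<open>?f\<close>. The probability of that bit is half the factor in \<open>weight\<close>;
  averaging over \<open>X\<close> gives the likelihood.\<close>

lemma prob_no_labels:
  assumes "valid (n * d) \<sigma>" "matches p \<sigma>" "0 \<le> \<epsilon>" "\<epsilon> \<le> 1"
  shows "measure_pmf.prob (no_labels n d \<epsilon> p) {Y. (p, Y) \<in> extending \<sigma>} =
    (1/2) ^ length \<sigma> * likelihood n d (1 - 2 * \<epsilon>) \<sigma>"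
proof -
  let ?f = "\<lambda>X h h' y. y \<noteq> (X (h div d) \<noteq> X (h' div d))"
  have *: "measure_pmf.prob (Pi_pmf {..<n * d} False (\<lambda>_. bernoulli_pmf \<epsilon>))
        {Z. (p, \<lambda>h. (X (h div d) \<noteq> X (p h div d)) \<noteq> Z (min h (p h))) \<in> extending \<sigma>} =
      (1/2) ^ length \<sigma> * weight X (map (wedge_of d (1 - 2 * \<epsilon>)) \<sigma>)" for X :: "nat \<Rightarrow> bool"
  proof -
    have "{Z. (p, \<lambda>h. (X (h div d) \<noteq> X (p h div d)) \<noteq> Z (min h (p h))) \<in> extending \<sigma>} =
      {Z. \<forall>(h, h', y)\<in>set \<sigma>. Z (min h h') = ?f X h h' y}"
    proof -
      have "(\<forall>(h, h', y)\<in>set \<sigma>. ((X (h div d) \<noteq> X (p h div d)) \<noteq> Z (min h (p h))) = y \<and>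
             ((X (h' div d) \<noteq> X (p h' div d)) \<noteq> Z (min h' (p h'))) = y) \<longleftrightarrow>
            (\<forall>(h, h', y)\<in>set \<sigma>. Z (min h h') = ?f X h h' y)" for Z
        using matches_in[OF assms(2)]
        by (intro ball_cong refl) (clarsimp simp: min.commute, blast)
      then show ?thesis using assms(2) by (simp add: extending_def)
    qed
    then have "measure_pmf.prob (Pi_pmf {..<n * d} False (\<lambda>_. bernoulli_pmf \<epsilon>))
        {Z. (p, \<lambda>h. (X (h div d) \<noteq> X (p h div d)) \<noteq> Z (min h (p h))) \<in> extending \<sigma>} =
        (\<Prod>(h, h', y)\<leftarrow>\<sigma>. pmf (bernoulli_pmf \<epsilon>) (?f X h h' y))"
      using prob_cylinder[OF assms(1), of "bernoulli_pmf \<epsilon>" "?f X"] by simp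
    also have "\<dots> = (1/2) ^ length \<sigma> * weight X (map (wedge_of d (1 - 2 * \<epsilon>)) \<sigma>)"
    proof (induction \<sigma>)
      case (Cons e \<sigma>)
      obtain h h' y where e: "e = (h, h', y)" by (cases e) auto
      show ?case unfolding e using Cons assms(3,4)
        by (cases "X (h div d)"; cases "X (h' div d)"; cases y)
           (simp_all add: wedge_of_def spin_def field_simps)
    qed simp
    finally show ?thesis .
  qed
  have "measure_pmf.prob (no_labels n d \<epsilon> p) {Y. (p, Y) \<in> extending \<sigma>} =
    (\<Sum>X\<in>configs n. (1/2) ^ length \<sigma> * weight X (map (wedge_of d (1 - 2 * \<epsilon>)) \<sigma>)) / card (configs n)"
    unfolding no_labels_def spins_pmf
    by (subst prob_bind_pmf_of_set)
       (auto simp: configs_nonempty *[symmetric] map_pmf_def[symmetric] vimage_def)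
  then show ?thesis
    by (simp add: likelihood_def avg_def card_configs sum_distrib_left)
qed

text \<open>The label probability is the same for all pairings matching the exploration, so it
  factors out.\<close>

lemma prob_instance:
  assumes "even (n * d)"
    and "\<And>p. matches p \<sigma> \<Longrightarrow> measure_pmf.prob (labels p) {Y. (p, Y) \<in> extending \<sigma>} = c"
  shows "measure_pmf.prob (do {p \<leftarrow> pmf_of_set (pairings n d); Y \<leftarrow> labels p; return_pmf (p, Y)})
    (extending \<sigma>) = c * card (matching n d \<sigma>) / card (pairings n d)"
proof -
  have "measure_pmf.prob (map_pmf (Pair p) (labels p)) (extending \<sigma>) = (if matches p \<sigma> then c else 0)" for p
    using assms(2)[of p] by (simp add: vimage_def) (simp add: extending_def)
  then have "measure_pmf.prob (do {p \<leftarrow> pmf_of_set (pairings n d); Y \<leftarrow> labels p; return_pmf (p, Y)})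
      (extending \<sigma>) = (\<Sum>p\<in>pairings n d. if matches p \<sigma> then c else 0) / card (pairings n d)"
    by (subst prob_bind_pmf_of_set) (simp_all add: pairings_nonempty[OF assms(1)] map_pmf_def[symmetric])
  then show ?thesis
    by (simp add: sum.If_cases matching_def Int_def mult.commute)
qed

lemma prob_yes_extending:
  assumes "even (n * d)" "valid (n * d) \<sigma>"
  shows "measure_pmf.prob (yes_inst n d) (extending \<sigma>) =
    (1/2) ^ length \<sigma> * card (matching n d \<sigma>) / card (pairings n d)"
  unfolding yes_inst_def using prob_yes_labels[OF assms(2)] by (rule prob_instance[OF assms(1)])

lemma prob_no_extending:
  assumes "even (n * d)" "valid (n * d) \<sigma>" "0 \<le> \<epsilon>" "\<epsilon> \<le> 1"
  shows "measure_pmf.prob (no_inst n d \<epsilon>) (extending \<sigma>) =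
    likelihood n d (1 - 2 * \<epsilon>) \<sigma> * measure_pmf.prob (yes_inst n d) (extending \<sigma>)"
  unfolding prob_yes_extending[OF assms(1,2)] unfolding no_inst_def
  by (subst prob_instance[OF assms(1) prob_no_labels[OF assms(2) _ assms(3,4)]]) simp_all

text \<open>Conjugation by the transposition of \<open>a\<close> and \<open>b\<close> turns pairings
  that match \<open>h\<close> to \<open>a\<close> into pairings that match \<open>h\<close> to
  \<open>b\<close>. It respects \<open>\<sigma>\<close> because both half-edges are unmatched there.
  Used in both directions, it shows that the partner of \<open>h\<close> is uniform.\<close>

lemma card_matching_Cons_le:
  assumes "valid (n * d) ((h, a, y) # \<sigma>)" "valid (n * d) ((h, b, z) # \<sigma>)"
  shows "card (matching n d ((h, a, y) # \<sigma>)) \<le> card (matching n d ((h, b, z) # \<sigma>))"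
proof -
  let ?t = "Transposition.transpose a b"
  let ?g = "\<lambda>p. ?t \<circ> p \<circ> ?t"
  show ?thesis
  proof (rule card_inj_on_le)
    show "inj_on ?g (matching n d ((h, a, y) # \<sigma>))"
    proof (rule inj_onI)
      fix p q assume "?g p = ?g q"
      then have "?t \<circ> ?g p \<circ> ?t = ?t \<circ> ?g q \<circ> ?t" by simp
      then show "p = q" by (simp add: fun_eq_iff)
    qed
    show "?g ` matching n d ((h, a, y) # \<sigma>) \<subseteq> matching n d ((h, b, z) # \<sigma>)"
    proof safe
      fix p assume p: "p \<in> matching n d ((h, a, y) # \<sigma>)"
      have ab: "a < n * d" "b < n * d" "h \<noteq> a" "h \<noteq> b" "a \<notin> matched \<sigma>" "b \<notin> matched \<sigma>"
        using assms by auto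
      have t_less: "?t x < n * d \<longleftrightarrow> x < n * d" for x
        using ab by (auto simp: Transposition.transpose_def)
      have "?g p \<in> pairings n d"
        unfolding pairings_def
      proof (intro CollectI conjI allI impI)
        fix x assume x: "x < n * d"
        then have px: "p (?t x) < n * d" "p (?t x) \<noteq> ?t x" "p (p (?t x)) = ?t x"
          using p t_less[of x] by (auto simp: matching_def pairings_def)
        show "?g p x < n * d" using px t_less by simp
        show "?g p x \<noteq> x" using px by (metis comp_apply transpose_involutory)
        show "?g p (?g p x) = x" using px by simp
      next
        fix x assume "n * d \<le> x"
        moreover have "p x = x" using p calculation by (auto simp: matching_def pairings_def)
        ultimately show "?g p x = x" using ab by (simp add: Transposition.transpose_def)
      qed
      moreover have "matches (?g p) ((h, b, z) # \<sigma>)"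
      proof -
        have "?t c = c" if "c \<in> matched \<sigma>" for c
          using that ab by (auto simp: Transposition.transpose_def)
        moreover have "h' \<in> matched \<sigma> \<and> h'' \<in> matched \<sigma>" if "(h', h'', y) \<in> set \<sigma>" for h' h'' y
          using that by (auto simp: matched_def)
        ultimately have "matches (?g p) \<sigma>"
          using p by (fastforce simp: matching_def matches_def)
        then show ?thesis using p ab by (auto simp: matching_def Transposition.transpose_def)
      qed
      ultimately show "?g p \<in> matching n d ((h, b, z) # \<sigma>)" by (simp add: matching_def)
    qed
    show "finite (matching n d ((h, b, z) # \<sigma>))" by (simp add: matching_def)
  qed
qed

lemma prob_yes_extending_Cons:
  assumes "even (n * d)" "valid (n * d) ((h, a, y) # \<sigma>)" "valid (n * d) ((h, b, z) # \<sigma>)"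
  shows "measure_pmf.prob (yes_inst n d) (extending ((h, a, y) # \<sigma>)) =
    measure_pmf.prob (yes_inst n d) (extending ((h, b, z) # \<sigma>))"
  using card_matching_Cons_le[OF assms(2,3)] card_matching_Cons_le[OF assms(3,2)]
  by (simp only: prob_yes_extending[OF assms(1,2)] prob_yes_extending[OF assms(1,3)]) simp

definition partners :: "nat \<Rightarrow> reveal list \<Rightarrow> nat \<Rightarrow> nat set" where
  "partners N \<sigma> h = {..<N} - insert h (matched \<sigma>)"

lemma valid_partner:
  "valid N \<sigma> \<Longrightarrow> h < N \<Longrightarrow> h \<notin> matched \<sigma> \<Longrightarrow> h' \<in> partners N \<sigma> h \<Longrightarrow> valid N ((h, h', y) # \<sigma>)"
  by (auto simp: partners_def)

lemma card_partners:
  assumes "valid N \<sigma>" "h < N" "h \<notin> matched \<sigma>"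
  shows "card (partners N \<sigma> h) = N - (2 * length \<sigma> + 1)"
  unfolding partners_def using assms matched_less[OF assms(1)]
  by (subst card_Diff_subset) (auto simp: card_matched)

text \<open>The partner and the label of \<open>h\<close> split the event into disjoint cases, up to
  instances outside \<open>consistent n d\<close>.\<close>

lemma prob_extending_split:
  assumes "set_pmf M \<subseteq> consistent n d" "valid (n * d) \<sigma>" "h < n * d" "h \<notin> matched \<sigma>"
  shows "measure_pmf.prob M (extending \<sigma> \<inter> B) =
    (\<Sum>h'\<in>partners (n * d) \<sigma> h. \<Sum>y\<in>UNIV. measure_pmf.prob M (extending ((h, h', y) # \<sigma>) \<inter> B))"
proof -
  let ?P = "partners (n * d) \<sigma> h"
  have "extending \<sigma> \<inter> B \<inter> set_pmf M =
      (\<Union>(h', y)\<in>?P \<times> UNIV. extending ((h, h', y) # \<sigma>) \<inter> B) \<inter> set_pmf M" (is "?l = ?r")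
  proof
    show "?r \<subseteq> ?l" by (auto simp: extending_def)
    show "?l \<subseteq> ?r"
    proof
      fix I assume I: "I \<in> ?l"
      obtain p Y where pY: "I = (p, Y)" by (cases I)
      from I assms(1) have p: "p \<in> pairings n d" "Y (p h) = Y h" "matches p \<sigma>"
        by (auto simp: pY consistent_def extending_def)
      have inv: "p (p x) = x" for x using pairings_involution[OF p(1)] .
      \<comment> \<open>Otherwise \<open>h\<close> would already be matched, as \<open>p\<close> is
        an involution.\<close>
      have "p h \<notin> matched \<sigma>"
      proof
        assume "p h \<in> matched \<sigma>"
        then obtain a b c where "(a, b, c) \<in> set \<sigma>" "p h = a \<or> p h = b" by (auto simp: matched_def)
        then show False using assms(4) matches_in[OF p(3)] inv unfolding matched_def by fastforce
      qed
      then have "p h \<in> ?P" using p(1) assms(3) by (auto simp: partners_def pairings_def)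
      then show "I \<in> ?r" using I p inv
        by (intro IntI UN_I[of "(p h, Y h)"]) (auto simp: extending_def pY)
    qed
  qed
  then have "measure_pmf.prob M (extending \<sigma> \<inter> B) =
      measure_pmf.prob M (\<Union>(h', y)\<in>?P \<times> UNIV. extending ((h, h', y) # \<sigma>) \<inter> B)"
    by (metis measure_Int_set_pmf)
  also have "\<dots> = (\<Sum>(h', y)\<in>?P \<times> UNIV. measure_pmf.prob M (extending ((h, h', y) # \<sigma>) \<inter> B))"
    unfolding case_prod_unfold
    by (intro measure_pmf.finite_measure_finite_Union)
       (auto simp: partners_def disjoint_family_on_def extending_def)
  finally show ?thesis by (simp add: sum.cartesian_product)
qed

section \<open>Bounding the advantage\<close>

lemma card_halfedges_le:
  assumes "d > 0" "finite (B :: nat set)" "card B \<le> c" "T \<subseteq> {h. h div d \<in> B}"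
  shows "real (card T) \<le> real d * real c"
proof -
  have "card T \<le> d * card B"
    using card_halfedges[OF assms(1,2)] assms(4) card_mono by metis
  also have "\<dots> \<le> d * c" using assms(3) by simp
  finally show ?thesis by (metis of_nat_le_iff of_nat_mult)
qed

text \<open>\<open>K\<close> limits the reveals, \<open>R\<close> the collisions, and
  \<open>2 * r\<close> is the required separation.\<close>

locale exploration =
  fixes n d r R K :: nat and \<epsilon> :: real
  assumes d_pos: "d > 0" and R_pos: "R > 0" and K_small: "2 * K < n * d"
    and even_nd: "even (n * d)" and eps: "0 \<le> \<epsilon>" "\<epsilon> \<le> 1/2"
begin

text \<open>Bounds the chance of a collision: at most \<open>2 * K\<close> vertices with
  \<open>d\<close> half-edges each, against at least \<open>n * d - 2 * K\<close> possible
  partners.\<close>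

definition collision_rate :: real where
  "collision_rate = 2 * real K * real d / (real (n * d) - 2 * real K)"

text \<open>Bounds the chance that the partner lies in a ball around at most \<open>2 * R\<close>
  chord ends and the vertex of the current half-edge.\<close>

definition closeness_rate :: real where
  "closeness_rate = real d * real ((d + 1) ^ (2 * r) * (2 * R + 1)) / (real (n * d) - 2 * real K)"

text \<open>The bound of \<open>card_near_reveals_le\<close> at \<open>R\<close> collisions, plus 1
  for the reveal in progress.\<close>

definition near_cap :: real where
  "near_cap = 2 * real d * real (d + 1) ^ (2 * r) * real R + 1"

abbreviation collisions :: "reveal list \<Rightarrow> nat" where
  "collisions \<sigma> \<equiv> length (chords d 0 \<sigma>)"

text \<open>Under uniform labels this is a supermartingale bounding the probability that one of the next
  \<open>m\<close> reveals is a bad step or takes the number of collisions above \<open>R\<close>. The term with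
  \<^term>\<open>near_cap\<close> pays for reveals started near earlier collisions: there are at most \<^term>\<open>near_cap\<close>
  of these on every path.\<close>
definition potential :: "nat \<Rightarrow> reveal list \<Rightarrow> real" where
  "potential m \<sigma> = (real (collisions \<sigma>) + real m * collision_rate) / R + real m * closeness_rate +
     collision_rate * (near_cap - real (card (near_reveals d r \<sigma>)))"

text \<open>The value 1 after a failure makes the bound on the advantage trivial.\<close>

definition risk :: "nat \<Rightarrow> reveal list \<Rightarrow> real" where
  "risk m \<sigma> = (if good d r \<sigma> \<and> collisions \<sigma> \<le> R then potential m \<sigma> else 1)"

definition bias :: real where
  "bias = (1 + (1 - 2 * \<epsilon>) ^ (2 * r)) ^ R - 1"

text \<open>The excess of YES over NO mass is measured against the YES mass of the exploration, so
  the claims for all possible next reveals add up.\<close>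

definition advantage_bounded :: "nat \<Rightarrow> reveal list \<Rightarrow> np_instance set \<Rightarrow> bool" where
  "advantage_bounded m \<sigma> B \<longleftrightarrow>
     measure_pmf.prob (yes_inst n d) (extending \<sigma> \<inter> B) -
     measure_pmf.prob (no_inst n d \<epsilon>) (extending \<sigma> \<inter> B) \<le>
     measure_pmf.prob (yes_inst n d) (extending \<sigma>) * (bias + risk m \<sigma>)"

lemma denominator_pos: "0 < real (n * d) - 2 * real K"
  using K_small by (metis diff_gt_0_iff_gt of_nat_less_iff of_nat_mult of_nat_numeral)

lemma rates_nonneg: "0 \<le> collision_rate" "0 \<le> closeness_rate"
  using denominator_pos unfolding collision_rate_def closeness_rate_def by simp_all

lemma bias_nonneg: "0 \<le> bias"
  using eps unfolding bias_def by simp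

lemma card_near_reveals_le_cap:
  assumes "matches p \<sigma>" "collisions \<sigma> \<le> R"
  shows "real (card (near_reveals d r \<sigma>)) \<le> near_cap - 1"
proof -
  have "card (near_reveals d r \<sigma>) \<le> 2 * d * (d + 1) ^ (2 * r) * R"
    using card_near_reveals_le[OF assms(1) d_pos] assms(2) by (meson mult_le_mono2 order_trans)
  then have "real (card (near_reveals d r \<sigma>)) \<le> real (2 * d * (d + 1) ^ (2 * r) * R)"
    by (rule of_nat_mono)
  then show ?thesis by (simp add: near_cap_def)
qed

lemma potential_nonneg:
  assumes "matches p \<sigma>" "collisions \<sigma> \<le> R"
  shows "0 \<le> potential m \<sigma>"
  using card_near_reveals_le_cap[OF assms] rates_nonneg unfolding potential_def
  by (intro add_nonneg_nonneg mult_nonneg_nonneg divide_nonneg_nonneg) auto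

lemma risk_nonneg: "matches p \<sigma> \<Longrightarrow> 0 \<le> risk m \<sigma>"
  using potential_nonneg by (auto simp: risk_def)

lemma risk_mono: "risk m \<sigma> \<le> risk (Suc m) \<sigma>"
  using rates_nonneg R_pos by (simp add: risk_def potential_def field_simps)

text \<open>The supermartingale step before averaging. A bad step costs 1 and a collision
  \<open>1 / R\<close>; once the count exceeds \<open>R\<close>, its quotient by \<open>R\<close>
  exceeds 1 and pays for the failure.\<close>

lemma risk_Cons_le:
  assumes "matches p \<sigma>" "collisions \<sigma> \<le> R" "good d r \<sigma>" "h \<notin> matched \<sigma>"
  shows "risk m ((h, h', y) # \<sigma>) \<le> of_bool (bad_step d r \<sigma> h h') + of_bool (collides d \<sigma> h h') / R +
    (potential (Suc m) \<sigma> - collision_rate / R - closeness_rate -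
     collision_rate * of_bool (h div d \<in> near d r \<sigma>))"
proof -
  let ?\<sigma> = "(h, h', y) # \<sigma>"
  let ?coll = "of_bool (collides d \<sigma> h h') :: real" and ?near = "of_bool (h div d \<in> near d r \<sigma>) :: real"
  let ?a = "real (card (near_reveals d r \<sigma>))"
  define rest where "rest = real m * collision_rate / R + real m * closeness_rate +
     collision_rate * (near_cap - ?a - ?near)"
  have rest: "0 \<le> rest"
    using card_near_reveals_le_cap[OF assms(1,2)] rates_nonneg unfolding rest_def
    by (intro add_nonneg_nonneg mult_nonneg_nonneg divide_nonneg_nonneg) auto
  have rhs: "potential (Suc m) \<sigma> - collision_rate / R - closeness_rate - collision_rate * ?near =
      real (collisions \<sigma>) / R + rest"
    by (simp add: potential_def rest_def field_simps add_divide_distrib)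
  have cs: "real (collisions ?\<sigma>) = real (collisions \<sigma>) + ?coll" by simp
  have near: "real (card (near_reveals d r ?\<sigma>)) = ?a + ?near"
    using card_near_reveals_Cons[OF assms(4)] by simp
  consider "bad_step d r \<sigma> h h'" | "\<not> bad_step d r \<sigma> h h'" "collisions ?\<sigma> > R"
    | "\<not> bad_step d r \<sigma> h h'" "collisions ?\<sigma> \<le> R" by linarith
  then show ?thesis
  proof cases
    case 1
    then show ?thesis unfolding rhs using rest by (simp add: risk_def)
  next
    case 2
    then have "real R < real (collisions \<sigma>) + ?coll" using cs by linarith
    then have "1 \<le> (real (collisions \<sigma>) + ?coll) / R" using R_pos by simp
    then show ?thesis unfolding rhs using rest 2 by (simp add: risk_def add_divide_distrib)
  next
    case 3
    have "potential m ?\<sigma> = ?coll / R + (real (collisions \<sigma>) / R + rest)"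
      unfolding potential_def cs near rest_def by (simp add: add_divide_distrib)
    then show ?thesis unfolding rhs using 3 assms(3) by (simp add: risk_def)
  qed
qed

text \<open>On averaging over the partner, the rates subtracted in \<open>risk_Cons_le\<close> cover
  the expected costs of bad steps and collisions.\<close>

lemma sum_risk_le:
  assumes "matches p \<sigma>" "collisions \<sigma> \<le> R" "good d r \<sigma>" "valid (n * d) \<sigma>"
    and "h < n * d" "h \<notin> matched \<sigma>" "length \<sigma> < K"
  shows "(\<Sum>h'\<in>partners (n * d) \<sigma> h. risk m ((h, h', y) # \<sigma>)) \<le>
    card (partners (n * d) \<sigma> h) * potential (Suc m) \<sigma>"
proof -
  let ?P = "partners (n * d) \<sigma> h" and ?u = "h div d"
  let ?near = "of_bool (?u \<in> near d r \<sigma>) :: real"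
  let ?C = "{h' \<in> ?P. collides d \<sigma> h h'}" and ?B = "{h' \<in> ?P. bad_step d r \<sigma> h h'}"
  let ?L = "ball_of (fedges d \<sigma>) (2 * r) (insert ?u (chord_ends d \<sigma>))"
  have fin: "finite ?P" by (simp add: partners_def)
  have N: "real (n * d) - 2 * real K \<le> real (card ?P)"
  proof -
    have "real (n * d - (2 * length \<sigma> + 1)) = real (n * d) - (2 * real (length \<sigma>) + 1)"
      using assms(7) K_small by (subst of_nat_diff) auto
    moreover have "2 * real (length \<sigma>) + 1 \<le> 2 * real K" using assms(7) by linarith
    ultimately show ?thesis using card_partners[OF assms(4-6)] by linarith
  qed
  have C: "real (card ?C) \<le> real (card ?P) * collision_rate"
  proof -
    have "card (insert ?u (seen d \<sigma>)) \<le> 2 * K"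
      using card_seen_le[of d \<sigma>] assms(7) by (simp add: card_insert_if)
    then have "real (card ?C) \<le> real d * real (2 * K)"
      by (intro card_halfedges_le[where B = "insert ?u (seen d \<sigma>)"] d_pos) (auto simp: collides_def)
    also have "\<dots> = (real (n * d) - 2 * real K) * collision_rate"
      using denominator_pos by (simp add: collision_rate_def)
    also have "\<dots> \<le> real (card ?P) * collision_rate"
      using N rates_nonneg by (intro mult_right_mono)
    finally show ?thesis .
  qed
  have B: "real (card ?B) \<le> real (card ?P) * (collision_rate * ?near + closeness_rate)"
  proof -
    \<comment> \<open>From a near vertex every collision is bad; otherwise the partner must hit the
      ball \<open>?L\<close>, which has few vertices.\<close>
    let ?B1 = "{h' \<in> ?P. collides d \<sigma> h h' \<and> ?u \<in> near d r \<sigma>}" and ?B2 = "{h' \<in> ?P. h' div d \<in> ?L}"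
    have "card (insert ?u (chord_ends d \<sigma>)) \<le> 2 * R + 1"
      using card_chord_ends_le[of d \<sigma>] assms(2) by (simp add: card_insert_if)
    then have "(d + 1) ^ (2 * r) * card (insert ?u (chord_ends d \<sigma>)) \<le> (d + 1) ^ (2 * r) * (2 * R + 1)"
      by (rule mult_le_mono2)
    moreover have "card ?L \<le> (d + 1) ^ (2 * r) * card (insert ?u (chord_ends d \<sigma>))"
      by (intro card_ball_of_le[OF assms(1) d_pos]) simp
    ultimately have "card ?L \<le> (d + 1) ^ (2 * r) * (2 * R + 1)" by (rule order_trans[rotated])
    then have "real (card ?B2) \<le> real d * real ((d + 1) ^ (2 * r) * (2 * R + 1))"
      by (intro card_halfedges_le[where B = ?L] d_pos finite_ball_of) auto
    also have "\<dots> = (real (n * d) - 2 * real K) * closeness_rate"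
      using denominator_pos by (simp add: closeness_rate_def)
    also have "\<dots> \<le> real (card ?P) * closeness_rate"
      using N rates_nonneg by (intro mult_right_mono)
    finally have B2: "real (card ?B2) \<le> real (card ?P) * closeness_rate" .
    have B1: "real (card ?B1) \<le> real (card ?P) * collision_rate * ?near"
      using C by (cases "?u \<in> near d r \<sigma>") auto
    have "card ?B \<le> card (?B1 \<union> ?B2)"
      using fin by (intro card_mono) (auto simp: bad_step_def)
    also have "\<dots> \<le> card ?B1 + card ?B2" by (rule card_Un_le)
    finally show ?thesis using B1 B2 by (simp add: algebra_simps)
  qed
  have "(\<Sum>h'\<in>?P. risk m ((h, h', y) # \<sigma>)) \<le>
      (\<Sum>h'\<in>?P. of_bool (bad_step d r \<sigma> h h') + of_bool (collides d \<sigma> h h') / R +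
      (potential (Suc m) \<sigma> - collision_rate / R - closeness_rate - collision_rate * ?near))"
    by (intro sum_mono risk_Cons_le[OF assms(1-3,6)])
  also have "\<dots> = real (card ?B) + real (card ?C) / R +
      real (card ?P) * (potential (Suc m) \<sigma> - collision_rate / R - closeness_rate - collision_rate * ?near)"
    using fin by (simp add: sum.distrib sum_divide_distrib[symmetric] Int_def of_bool_def
        flip: sum.inter_filter)
  also have "\<dots> \<le> real (card ?P) * (collision_rate * ?near + closeness_rate) +
      real (card ?P) * collision_rate / R +
      real (card ?P) * (potential (Suc m) \<sigma> - collision_rate / R - closeness_rate - collision_rate * ?near)"
    by (intro add_mono B divide_right_mono C order_refl) simp
  also have "\<dots> = real (card ?P) * potential (Suc m) \<sigma>"
    by (simp add: algebra_simps)
  finally show ?thesis .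
qed

section \<open>Induction along the exploration\<close>

lemma advantage_bounded_trivial:
  assumes "risk m \<sigma> = 1 \<or> measure_pmf.prob (yes_inst n d) (extending \<sigma>) = 0"
  shows "advantage_bounded m \<sigma> B"
proof -
  let ?y = "measure_pmf.prob (yes_inst n d)"
  have "?y (extending \<sigma> \<inter> B) \<le> ?y (extending \<sigma>)"
    by (intro measure_pmf.finite_measure_mono) auto
  also have "\<dots> \<le> ?y (extending \<sigma>) * (bias + risk m \<sigma>)"
    using assms bias_nonneg by (auto simp: algebra_simps)
  finally show ?thesis
    unfolding advantage_bounded_def
    using measure_nonneg[of "measure_pmf (no_inst n d \<epsilon>)" "extending \<sigma> \<inter> B"] by linarith
qed

text \<open>An exploration of positive YES probability is matched by some pairing, from which the
  degree bounds follow.\<close>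

lemma advantage_bounded_cases:
  assumes "valid (n * d) \<sigma>"
    and "\<And>p. matches p \<sigma> \<Longrightarrow> good d r \<sigma> \<Longrightarrow> collisions \<sigma> \<le> R \<Longrightarrow> advantage_bounded m \<sigma> B"
  shows "advantage_bounded m \<sigma> B"
proof (cases "risk m \<sigma> = 1 \<or> measure_pmf.prob (yes_inst n d) (extending \<sigma>) = 0")
  case False
  then have "matching n d \<sigma> \<noteq> {}" using prob_yes_extending[OF even_nd assms(1)] by auto
  moreover have "good d r \<sigma>" "collisions \<sigma> \<le> R" using False by (auto simp: risk_def split: if_splits)
  ultimately show ?thesis using assms(2) by (auto simp: matching_def)
qed (rule advantage_bounded_trivial)

text \<open>Once the answer is fixed, \<open>B\<close> is everything or nothing, and the NO mass is
  the likelihood times the YES mass.\<close>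

lemma advantage_bounded_leaf:
  assumes "valid (n * d) \<sigma>" "B = UNIV \<or> B = {}"
  shows "advantage_bounded m \<sigma> B"
proof (rule advantage_bounded_cases[OF assms(1)])
  fix p assume *: "matches p \<sigma>" "good d r \<sigma>" "collisions \<sigma> \<le> R"
  let ?y = "measure_pmf.prob (yes_inst n d) (extending \<sigma>)"
  have "1 - likelihood n d (1 - 2 * \<epsilon>) \<sigma> \<le> bias"
    using likelihood_ge[OF assms(1) *(2) _ _ *(3), of "1 - 2 * \<epsilon>"] eps by (simp add: bias_def)
  then have "?y * (1 - likelihood n d (1 - 2 * \<epsilon>) \<sigma>) \<le> ?y * (bias + risk m \<sigma>)"
    using risk_nonneg[OF *(1), of m] by (intro mult_left_mono) auto
  moreover have "measure_pmf.prob (no_inst n d \<epsilon>) (extending \<sigma>) = likelihood n d (1 - 2 * \<epsilon>) \<sigma> * ?y"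
    using eps by (intro prob_no_extending even_nd assms(1)) auto
  moreover have "0 \<le> ?y * (bias + risk m \<sigma>)"
    using risk_nonneg[OF *(1), of m] bias_nonneg by simp
  ultimately show "advantage_bounded m \<sigma> B"
    using assms(2) unfolding advantage_bounded_def by (auto simp: algebra_simps)
qed

text \<open>All continuations by a partner and a label have the same YES mass \<open>w\<close>, so
  their risks enter with equal weights, as in \<open>sum_risk_le\<close>.\<close>

lemma advantage_bounded_step:
  assumes "valid (n * d) \<sigma>" "h < n * d" "h \<notin> matched \<sigma>" "length \<sigma> < K"
    and step: "\<And>h' y. h' \<in> partners (n * d) \<sigma> h \<Longrightarrow> advantage_bounded m ((h, h', y) # \<sigma>) B"
  shows "advantage_bounded (Suc m) \<sigma> B"
proof (rule advantage_bounded_cases[OF assms(1)])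
  fix p assume *: "matches p \<sigma>" "good d r \<sigma>" "collisions \<sigma> \<le> R"
  let ?P = "partners (n * d) \<sigma> h"
  let ?y = "measure_pmf.prob (yes_inst n d)" and ?n = "measure_pmf.prob (no_inst n d \<epsilon>)"
  let ?ext = "\<lambda>h' y. extending ((h, h', y) # \<sigma>)"
  note splits = prob_extending_split[OF set_yes_inst[OF even_nd] assms(1-3)]
    prob_extending_split[OF set_no_inst[OF even_nd] assms(1-3)]
  obtain w where w: "\<And>h' y. h' \<in> ?P \<Longrightarrow> ?y (?ext h' y) = w" "0 \<le> w"
  proof (cases "?P = {}")
    case False
    then obtain a where "a \<in> ?P" by auto
    then have "?y (?ext h' y) = ?y (?ext a True)" if "h' \<in> ?P" for h' y
      using that by (intro prob_yes_extending_Cons even_nd valid_partner assms)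
    then show ?thesis using that measure_nonneg by blast
  qed (use that[of 0] in auto)
  have total: "?y (extending \<sigma>) = 2 * real (card ?P) * w"
    using splits(1)[of UNIV] w(1) by simp
  have "?y (extending \<sigma> \<inter> B) - ?n (extending \<sigma> \<inter> B) =
      (\<Sum>h'\<in>?P. \<Sum>y\<in>UNIV. ?y (?ext h' y \<inter> B) - ?n (?ext h' y \<inter> B))"
    unfolding splits by (simp add: sum_subtractf)
  also have "\<dots> \<le> (\<Sum>h'\<in>?P. \<Sum>y\<in>(UNIV :: bool set). w * (bias + risk m ((h, h', True) # \<sigma>)))"
  proof (intro sum_mono)
    fix h' and y :: bool assume "h' \<in> ?P"
    \<comment> \<open>The label affects neither the forest edges nor the collisions.\<close>
    moreover have "risk m ((h, h', y) # \<sigma>) = risk m ((h, h', True) # \<sigma>)"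
      by (simp add: risk_def potential_def)
    ultimately show "?y (?ext h' y \<inter> B) - ?n (?ext h' y \<inter> B) \<le> w * (bias + risk m ((h, h', True) # \<sigma>))"
      using step[of h' y] w(1)[of h' y] unfolding advantage_bounded_def by simp
  qed
  also have "\<dots> = 2 * w * (real (card ?P) * bias + (\<Sum>h'\<in>?P. risk m ((h, h', True) # \<sigma>)))"
    by (simp add: sum.distrib sum_distrib_left distrib_left mult_ac)
  also have "\<dots> \<le> 2 * w * (real (card ?P) * bias + real (card ?P) * potential (Suc m) \<sigma>)"
    using w(2) by (intro mult_left_mono add_left_mono sum_risk_le[OF *(1,3,2) assms(1-4)]) auto
  also have "\<dots> = ?y (extending \<sigma>) * (bias + risk (Suc m) \<sigma>)"
    using * unfolding total by (simp add: risk_def algebra_simps)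
  finally show "advantage_bounded (Suc m) \<sigma> B" unfolding advantage_bounded_def .
qed

lemma advantage_bounded_mono:
  assumes "advantage_bounded m \<sigma> B"
  shows "advantage_bounded (Suc m) \<sigma> B"
proof -
  have "measure_pmf.prob (yes_inst n d) (extending \<sigma>) * (bias + risk m \<sigma>) \<le>
      measure_pmf.prob (yes_inst n d) (extending \<sigma>) * (bias + risk (Suc m) \<sigma>)"
    using risk_mono[of m \<sigma>] by (intro mult_left_mono) auto
  then show ?thesis using assms unfolding advantage_bounded_def by linarith
qed

text \<open>Half-edges already matched or out of range need no reveal; monotonicity in the budget
  absorbs them.\<close>

lemma advantage_bounded_reveal:
  assumes "\<And>\<sigma>. valid (n * d) \<sigma> \<Longrightarrow> \<forall>h\<in>V. h \<in> matched \<sigma> \<or> n * d \<le> h \<Longrightarrow> length \<sigma> + m \<le> K \<Longrightarrow>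
      advantage_bounded m \<sigma> B"
    and "valid (n * d) \<sigma>" "\<forall>h\<in>V. h \<in> matched \<sigma> \<or> n * d \<le> h \<or> h \<in> set hs"
    and "length \<sigma> + (m + length hs) \<le> K"
  shows "advantage_bounded (m + length hs) \<sigma> B"
  using assms(2-4)
proof (induction hs arbitrary: \<sigma>)
  case Nil
  then show ?case using assms(1) by auto
next
  case (Cons h hs)
  show ?case
  proof (cases "h \<in> matched \<sigma> \<or> n * d \<le> h")
    case True
    then have "advantage_bounded (m + length hs) \<sigma> B" using Cons by (intro Cons.IH) auto
    then show ?thesis using advantage_bounded_mono by simp
  next
    case False
    then have h: "h < n * d" "h \<notin> matched \<sigma>" by auto
    have "advantage_bounded (Suc (m + length hs)) \<sigma> B"
    proof (rule advantage_bounded_step[OF Cons.prems(1) h])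
      show "length \<sigma> < K" using Cons.prems by simp
      show "advantage_bounded (m + length hs) ((h, h', y) # \<sigma>) B"
        if "h' \<in> partners (n * d) \<sigma> h" for h' y
        using Cons.prems valid_partner[OF Cons.prems(1) h that] by (intro Cons.IH) auto
    qed
    then show ?thesis by simp
  qed
qed

lemma query_determined:
  assumes "I \<in> extending \<sigma> \<inter> consistent n d" "I' \<in> extending \<sigma> \<inter> consistent n d"
    and "\<forall>h\<in>{q * d..<q * d + d}. h \<in> matched \<sigma> \<or> n * d \<le> h"
  shows "query d I q = query d I' q"
proof -
  have "fst I h = fst I' h \<and> snd I h = snd I' h" if "h \<in> {q * d..<q * d + d}" for h
  proof (cases "h \<in> matched \<sigma>")
    case True
    then obtain a b y where "(a, b, y) \<in> set \<sigma>" "h = a \<or> h = b" by (auto simp: matched_def)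
    then show ?thesis using assms(1,2) by (fastforce simp: extending_def matches_def)
  next
    case False
    then show ?thesis using assms that by (auto simp: consistent_def pairings_def)
  qed
  then show ?thesis unfolding query_def by (intro arg_cong[where f = mset] map_cong) auto
qed

text \<open>One query is simulated by at most \<open>d\<close> reveals. Afterwards its answer is a
  constant, so the adaptive choice of the next query is fixed too.\<close>

lemma advantage_bounded_exec:
  assumes "valid (n * d) \<sigma>" "length \<sigma> + d * k \<le> K"
  shows "advantage_bounded (d * k) \<sigma> {I. exec d A I k hist = Some True}"
  using assms
proof (induction k arbitrary: \<sigma> hist)
  case 0
  show ?case
    by (intro advantage_bounded_leaf 0) (auto split: sum.splits)
next
  case (Suc k)
  show ?case
  proof (cases "A hist")
    case (Inr b)
    then show ?thesis by (intro advantage_bounded_leaf Suc.prems) auto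
  next
    case (Inl v)
    let ?hs = "[v * d..<v * d + d]" and ?B = "{I. exec d A I (Suc k) hist = Some True}"
    have "advantage_bounded (d * k + length ?hs) \<sigma> ?B"
    proof (rule advantage_bounded_reveal[where V = "set ?hs"])
      fix \<tau> assume \<tau>: "valid (n * d) \<tau>" "\<forall>h\<in>set ?hs. h \<in> matched \<tau> \<or> n * d \<le> h" "length \<tau> + d * k \<le> K"
      \<comment> \<open>The answer common to all instances that remain possible; arbitrary if there
        are none.\<close>
      define ans where "ans = query d (SOME I. I \<in> extending \<tau> \<inter> consistent n d) v"
      let ?B' = "{I. exec d A I k (hist @ [(v, ans)]) = Some True}"
      have "query d I v = ans" if "I \<in> extending \<tau> \<inter> consistent n d" for I
        unfolding ans_def using \<tau>(2) by (intro query_determined[OF that someI[where P = "\<lambda>I. I \<in> extending \<tau> \<inter> consistent n d", OF that]]) auto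
      then have eq: "extending \<tau> \<inter> ?B \<inter> consistent n d = extending \<tau> \<inter> ?B' \<inter> consistent n d"
        using Inl by auto
      have "measure_pmf.prob M (extending \<tau> \<inter> ?B) = measure_pmf.prob M (extending \<tau> \<inter> ?B')"
        if "set_pmf M \<subseteq> consistent n d" for M
      proof -
        have "extending \<tau> \<inter> ?B \<inter> set_pmf M = extending \<tau> \<inter> ?B' \<inter> set_pmf M"
          using eq that by blast
        then show ?thesis by (metis measure_Int_set_pmf)
      qed
      then show "advantage_bounded (d * k) \<tau> ?B"
        using Suc.IH[OF \<tau>(1,3), of "hist @ [(v, ans)]"] set_yes_inst[OF even_nd] set_no_inst[OF even_nd]
        unfolding advantage_bounded_def by metis
    qed (use Suc.prems in auto)
    then show ?thesis by (simp add: add.commute)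
  qed
qed

text \<open>In the NO case the two answers have total mass at most 1, so success exceeds 1/2 by at
  most half the advantage at the empty exploration.\<close>

lemma success_prob_le:
  assumes "K = d * k"
  shows "success_prob n d \<epsilon> k A \<le> 1/2 + (bias + K * collision_rate / R + K * closeness_rate +
    collision_rate * near_cap) / 2"
proof -
  let ?y = "measure_pmf.prob (yes_inst n d)" and ?n = "measure_pmf.prob (no_inst n d \<epsilon>)"
  let ?T = "{I. exec d A I k [] = Some True}" and ?F = "{I. exec d A I k [] = Some False}"
  have "extending [] = UNIV" by (auto simp: extending_def matches_def)
  then have "?y ?T - ?n ?T \<le> bias + potential K []"
    using advantage_bounded_exec[of "[]" k A "[]", folded assms]
    by (simp add: advantage_bounded_def risk_def)
  moreover have "?n ?T + ?n ?F \<le> 1"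
  proof -
    have "?n ?T + ?n ?F = ?n (?T \<union> ?F)"
      by (intro measure_pmf.finite_measure_Union[symmetric]) auto
    then show ?thesis by simp
  qed
  ultimately show ?thesis
    unfolding success_prob_eq by (simp add: potential_def add_divide_distrib) argo
qed

end

section \<open>Asymptotics\<close>

lemma success_prob_asymptotic_bound:
  fixes d n k :: nat and \<epsilon> \<beta> s b x :: real
  assumes d: "d \<ge> 3" and eps: "0 < \<epsilon>" "\<epsilon> \<le> 1/2" and even: "even (n * d)"
    and b: "b = 1 / (8 * ln (real d))" and x: "x = real n" "1 \<le> x"
    and \<beta>: "0 \<le> \<beta>" "\<beta> \<le> 1/16" and s: "0 < s" "s \<le> 1/32" "s \<le> b * \<epsilon> - \<beta>"
    and small: "4 * x powr (1/2 + \<beta>) \<le> x" and k: "real k \<le> x powr (1/2 + \<beta>)"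
  shows "success_prob n d \<epsilon> k A \<le> 1/2 + (exp (2 * exp (4 * \<epsilon>) * x powr - s) - 1 +
    4 * d\<^sup>2 * x powr - s + 10 * d * x powr (-1/32) + 20 * d\<^sup>2 * x powr (-1/32)) / 2"
proof -
  \<comment> \<open>As large as possible while balls of radius \<open>2 * r\<close> keep size at
    most \<open>x powr (1/4)\<close>, up to constants.\<close>
  define r where "r = nat \<lfloor>b * ln x / 2\<rfloor>"
  \<comment> \<open>About \<open>x powr (2 * \<beta>)\<close> collisions are expected; the extra
    \<open>s\<close> makes exceeding \<open>R\<close> unlikely by Markov's inequality.\<close>
  define R where "R = nat \<lceil>x powr (2 * \<beta> + s)\<rceil>"
  define K where "K = d * k"
  have ln_d: "0 < ln (real d)" using d by simp
  have b_pos: "0 < b" using ln_d by (simp add: b)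
  have ln_x: "0 \<le> ln x" using x by simp
  have x_pos: "0 < x" using x by simp
  have one_le: "1 \<le> x powr a" if "0 \<le> a" for a using that x by (simp add: ge_one_powr_ge_zero)
  have K: "real K \<le> d * x powr (1/2 + \<beta>)" using k by (simp add: K_def mult_left_mono)
  have half: "x * d / 2 \<le> x * d - 2 * real K"
  proof -
    have "4 * (d * x powr (1/2 + \<beta>)) \<le> d * x"
      using mult_left_mono[OF small, of "real d"] by (simp add: algebra_simps)
    then show ?thesis using K by (simp add: algebra_simps)
  qed
  have R_ge: "x powr (2 * \<beta> + s) \<le> R" and R_le: "real R \<le> 2 * x powr (2 * \<beta> + s)"
    and R_pos: "0 < R"
    using one_le[of "2 * \<beta> + s"] \<beta> s unfolding R_def by linarith+
  have small': "2 * K < n * d"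
  proof -
    have "0 < x * d" using x_pos d by simp
    then have "2 * real K < x * real d" using half by linarith
    then have "2 * real K < real n * real d" by (simp add: x(1))
    then show ?thesis by (metis of_nat_less_iff of_nat_mult of_nat_numeral)
  qed
  interpret exploration n d r R K \<epsilon>
    using d R_pos small' even eps by unfold_locales auto
  have "0 \<le> b * ln x" using b_pos ln_x by simp
  then have r_le: "2 * real r \<le> b * ln x" and r_ge: "b * ln x - 2 \<le> 2 * real r"
    unfolding r_def by linarith+
  have D: "real ((d + 1) ^ (2 * r)) \<le> x powr (1/4)"
  proof -
    \<comment> \<open>With \<open>b = 1 / (8 * ln d)\<close>, this factor 2 yields the exponent
      1/4.\<close>
    have "ln (real (d + 1)) \<le> 2 * ln d"
    proof -
      have "real (d + 1) \<le> real d ^ 2"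
      proof -
        have "3 \<le> real d" using d by simp
        moreover from this have "3 * real d \<le> real d * real d" by (intro mult_right_mono) auto
        ultimately show ?thesis unfolding power2_eq_square of_nat_add of_nat_1 by linarith
      qed
      then have "ln (real (d + 1)) \<le> ln (real d ^ 2)" using d by (subst ln_le_cancel_iff) auto
      then show ?thesis using d by (simp add: ln_realpow)
    qed
    then have "2 * real r * ln (real (d + 1)) \<le> (b * ln x) * (2 * ln d)"
      using \<open>ln (real (d + 1)) \<le> 2 * ln d\<close> \<open>0 \<le> b * ln x\<close> by (intro mult_mono[OF r_le]) auto
    also have "\<dots> = 1/4 * ln x" using ln_d by (simp add: b)
    finally have "exp (2 * real r * ln (real (d + 1))) \<le> exp (1/4 * ln x)"
      by (simp only: exp_le_cancel_iff)
    moreover have "exp (2 * real r * ln (real (d + 1))) = real ((d + 1) ^ (2 * r))"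
      using exp_of_nat_mult[of "2 * r" "ln (real (d + 1))"] by simp
    moreover have "exp (1/4 * ln x) = x powr (1/4)" using x_pos by (simp add: powr_def)
    ultimately show ?thesis by (simp only:)
  qed
  have cr: "collision_rate \<le> 4 * d * x powr (\<beta> - 1/2)"
  proof -
    have "collision_rate \<le> 2 * (d * x powr (1/2 + \<beta>)) * d / (x * d / 2)"
      unfolding collision_rate_def using half K x_pos d
      by (intro frac_le mult_mono) (auto simp: x(1))
    also have "\<dots> = 4 * d * (x powr (1/2 + \<beta>) / x powr 1)"
      using x_pos d by simp
    also have "\<dots> = 4 * d * x powr (\<beta> - 1/2)"
      unfolding powr_diff[symmetric] by (simp add: algebra_simps)
    finally show ?thesis .
  qed
  have cl: "closeness_rate \<le> 10 * x powr (2 * \<beta> + s - 3/4)"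
  proof -
    have "real (2 * R + 1) \<le> 5 * x powr (2 * \<beta> + s)"
      using R_le one_le[of "2 * \<beta> + s"] \<beta> s by simp
    then have "real ((d + 1) ^ (2 * r) * (2 * R + 1)) \<le> x powr (1/4) * (5 * x powr (2 * \<beta> + s))"
      unfolding of_nat_mult using D by (intro mult_mono) auto
    then have "closeness_rate \<le> d * (x powr (1/4) * (5 * x powr (2 * \<beta> + s))) / (x * d / 2)"
      unfolding closeness_rate_def using half x_pos d
      by (intro frac_le mult_left_mono) (auto simp: x(1))
    also have "\<dots> = 10 * (x powr (1/4) * x powr (2 * \<beta> + s) / x powr 1)"
      using x_pos d by simp
    also have "\<dots> = 10 * x powr (2 * \<beta> + s - 3/4)"
      unfolding powr_diff[symmetric] powr_add[symmetric] by (simp add: algebra_simps)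
    finally show ?thesis .
  qed
  have cap: "near_cap \<le> 5 * d * x powr (2 * \<beta> + s + 1/4)"
  proof -
    have "real d * (real ((d + 1) ^ (2 * r)) * real R) \<le> d * (x powr (1/4) * (2 * x powr (2 * \<beta> + s)))"
      using D R_le by (intro mult_left_mono mult_mono) auto
    also have "\<dots> = 2 * d * x powr (2 * \<beta> + s + 1/4)"
      by (simp add: powr_add)
    finally have "near_cap \<le> 4 * d * x powr (2 * \<beta> + s + 1/4) + 1"
      by (simp add: near_cap_def mult_ac)
    moreover have "1 * 1 \<le> d * x powr (2 * \<beta> + s + 1/4)"
      using one_le[of "2 * \<beta> + s + 1/4"] \<beta> s d by (intro mult_mono) auto
    ultimately show ?thesis by simp
  qed
  \<comment> \<open>The worst case is \<open>3/16 + 1/32 - 1/4 = -1/32\<close>.\<close>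
  have main_exp: "x powr (3 * \<beta> + s - 1/4) \<le> x powr (-1/32)"
    using x \<beta> s by (intro powr_mono) auto
  have 1: "K * collision_rate / R \<le> 4 * d\<^sup>2 * x powr - s"
  proof -
    have "K * collision_rate / R \<le>
        (d * x powr (1/2 + \<beta>)) * (4 * d * x powr (\<beta> - 1/2)) / x powr (2 * \<beta> + s)"
      using R_ge K cr x_pos rates_nonneg by (intro frac_le mult_mono) auto
    also have "\<dots> = 4 * d\<^sup>2 * (x powr (1/2 + \<beta>) * x powr (\<beta> - 1/2) / x powr (2 * \<beta> + s))"
      by (simp add: power2_eq_square)
    also have "\<dots> = 4 * d\<^sup>2 * x powr - s"
      unfolding powr_diff[symmetric] powr_add[symmetric] by (simp add: algebra_simps)
    finally show ?thesis .
  qed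
  have 2: "K * closeness_rate \<le> 10 * d * x powr (-1/32)"
  proof -
    have "K * closeness_rate \<le> (d * x powr (1/2 + \<beta>)) * (10 * x powr (2 * \<beta> + s - 3/4))"
      using K cl rates_nonneg by (intro mult_mono) auto
    also have "\<dots> = 10 * d * (x powr (1/2 + \<beta>) * x powr (2 * \<beta> + s - 3/4))" by simp
    also have "\<dots> = 10 * d * x powr (3 * \<beta> + s - 1/4)"
      unfolding powr_add[symmetric] by (simp add: algebra_simps)
    also have "\<dots> \<le> 10 * d * x powr (-1/32)" using main_exp by (intro mult_left_mono) auto
    finally show ?thesis .
  qed
  have 3: "collision_rate * near_cap \<le> 20 * d\<^sup>2 * x powr (-1/32)"
  proof -
    have "collision_rate * near_cap \<le> (4 * d * x powr (\<beta> - 1/2)) * (5 * d * x powr (2 * \<beta> + s + 1/4))"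
      using cr cap rates_nonneg by (intro mult_mono) (auto simp: near_cap_def)
    also have "\<dots> = 20 * d\<^sup>2 * (x powr (\<beta> - 1/2) * x powr (2 * \<beta> + s + 1/4))"
      by (simp add: power2_eq_square)
    also have "\<dots> = 20 * d\<^sup>2 * x powr (3 * \<beta> + s - 1/4)"
      unfolding powr_add[symmetric] by (simp add: algebra_simps)
    also have "\<dots> \<le> 20 * d\<^sup>2 * x powr (-1/32)" using main_exp by (intro mult_left_mono) auto
    finally show ?thesis .
  qed
  have 4: "bias \<le> exp (2 * exp (4 * \<epsilon>) * x powr - s) - 1"
  proof -
    let ?t = "(1 - 2 * \<epsilon>) ^ (2 * r)"
    have "1 - 2 * \<epsilon> \<le> exp (- 2 * \<epsilon>)" using exp_ge_add_one_self[of "- 2 * \<epsilon>"] by simp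
    then have "?t \<le> exp (- 2 * \<epsilon>) ^ (2 * r)" using eps by (intro power_mono) auto
    also have "\<dots> = exp (- (2 * \<epsilon>) * (2 * real r))"
      by (simp add: exp_of_nat_mult[symmetric] mult_ac)
    \<comment> \<open>Rounding loses at most 2 in \<open>2 * r\<close>, hence the factor
      \<open>exp (4 * \<epsilon>)\<close>.\<close>
    also have "\<dots> \<le> exp (4 * \<epsilon> + - (2 * b * \<epsilon>) * ln x)"
      using mult_left_mono[OF r_ge, of "2 * \<epsilon>"] eps by (simp add: algebra_simps)
    also have "\<dots> = exp (4 * \<epsilon>) * x powr (- (2 * b * \<epsilon>))"
      unfolding exp_add using x_pos by (simp add: powr_def)
    finally have "?t * R \<le> (exp (4 * \<epsilon>) * x powr (- (2 * b * \<epsilon>))) * (2 * x powr (2 * \<beta> + s))"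
      using R_le by (intro mult_mono) auto
    also have "\<dots> = 2 * exp (4 * \<epsilon>) * x powr (2 * \<beta> + s - 2 * b * \<epsilon>)"
      using powr_add[of x "- (2 * b * \<epsilon>)" "2 * \<beta> + s"] by (simp add: algebra_simps)
    \<comment> \<open>The exponent is at most \<open>- s\<close> because
      \<open>s \<le> b * \<epsilon> - \<beta>\<close>.\<close>
    also have "\<dots> \<le> 2 * exp (4 * \<epsilon>) * x powr - s"
      using x s by (intro mult_left_mono powr_mono) (auto simp: algebra_simps)
    finally have tR: "?t * R \<le> 2 * exp (4 * \<epsilon>) * x powr - s" .
    have "(1 + ?t) ^ R \<le> exp ?t ^ R" using eps exp_ge_add_one_self by (intro power_mono) auto
    also have "\<dots> = exp (?t * R)" by (simp add: exp_of_nat_mult[symmetric] mult_ac)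
    also have "\<dots> \<le> exp (2 * exp (4 * \<epsilon>) * x powr - s)" using tR by simp
    finally show ?thesis by (simp add: bias_def)
  qed
  show ?thesis
    by (rule order_trans[OF success_prob_le[OF K_def]])
       (intro add_left_mono divide_right_mono add_mono 1 2 3 4, simp)
qed

text \<open>The error \<open>g\<close> does not depend on the algorithm, so the o(1) is uniform over
  all algorithms. For odd \<open>n * d\<close> there are no pairings.\<close>

theorem theorem1p4:
  fixes d :: nat and \<epsilon> \<delta> :: real
  assumes "d \<ge> 3" and "0 < \<epsilon>" and "\<epsilon> \<le> 1/2"
    and "\<delta> < min (1/16) ((1 / (8 * ln (real d))) * \<epsilon>)"
  shows "\<forall>\<eta>>0. \<forall>\<^sub>F n in sequentially. even (n * d) \<longrightarrow>
           (\<forall>A. at_most_queries n d (nat \<lfloor>real n powr (1/2 + \<delta>)\<rfloor>) A \<longrightarrow>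
                success_prob n d \<epsilon> (nat \<lfloor>real n powr (1/2 + \<delta>)\<rfloor>) A \<le> 1/2 + \<eta>)"
proof (intro allI impI)
  fix \<eta> :: real assume \<eta>: "\<eta> > 0"
  define b where "b = 1 / (8 * ln (real d))"
  \<comment> \<open>\<open>\<delta>\<close> may be negative, while the estimates are stated for a
    nonnegative exponent.\<close>
  define \<beta> where "\<beta> = max \<delta> 0"
  define s where "s = min (1/32) (b * \<epsilon> - \<beta>)"
  have b: "b > 0" using assms(1) by (simp add: b_def)
  have \<beta>: "0 \<le> \<beta>" "\<beta> \<le> 1/16" "\<delta> \<le> \<beta>" "\<beta> < b * \<epsilon>"
    using assms b unfolding \<beta>_def b_def[symmetric] by auto
  have s: "0 < s" "s \<le> 1/32" "s \<le> b * \<epsilon> - \<beta>" using \<beta> by (auto simp: s_def min_def)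
  define g where "g n = exp (2 * exp (4 * \<epsilon>) * real n powr - s) - 1 + 4 * d\<^sup>2 * real n powr - s +
    10 * d * real n powr (-1/32) + 20 * d\<^sup>2 * real n powr (-1/32)" for n :: nat
  have lim: "(\<lambda>n. real n powr a) \<longlonglongrightarrow> 0" if "a < 0" for a
    using that by (intro tendsto_neg_powr filterlim_real_sequentially)
  have "g \<longlonglongrightarrow> exp (2 * exp (4 * \<epsilon>) * 0) - 1 + 4 * d\<^sup>2 * (0 :: real) +
    10 * d * (0 :: real) + 20 * d\<^sup>2 * (0 :: real)"
    unfolding g_def using s by (intro tendsto_intros lim) auto
  then have "g \<longlonglongrightarrow> 0" by simp
  then have "eventually (\<lambda>n. g n < 2 * \<eta>) sequentially" using \<eta> by (intro order_tendstoD) auto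
  \<comment> \<open>Yields the assumption \<open>small\<close>, under which at least half of the
    half-edges stay unmatched.\<close>
  moreover have "eventually (\<lambda>n. real n powr (\<beta> - 1/2) < 1/4) sequentially"
    using lim[of "\<beta> - 1/2"] \<beta> by (intro order_tendstoD) auto
  ultimately show "\<forall>\<^sub>F n in sequentially. even (n * d) \<longrightarrow>
           (\<forall>A. at_most_queries n d (nat \<lfloor>real n powr (1/2 + \<delta>)\<rfloor>) A \<longrightarrow>
                success_prob n d \<epsilon> (nat \<lfloor>real n powr (1/2 + \<delta>)\<rfloor>) A \<le> 1/2 + \<eta>)"
    using eventually_ge_at_top[of 1]
  proof eventually_elim
    case (elim n)
    show ?case
    proof (intro impI allI)
      fix A assume "even (n * d)"
      have n: "1 \<le> real n" using elim by simp
      have "real n powr (1/2 + \<beta>) = real n powr (\<beta> - 1/2) * real n powr 1"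
        unfolding powr_add[symmetric] by (simp add: add.commute)
      also have "\<dots> \<le> 1/4 * real n" using elim(2) mult_right_mono[of "real n powr (\<beta> - 1/2)" "1/4" "real n"] by simp
      finally have small: "4 * real n powr (1/2 + \<beta>) \<le> real n" by simp
      have "real (nat \<lfloor>real n powr (1/2 + \<delta>)\<rfloor>) \<le> real n powr (1/2 + \<delta>)" by simp
      also have "\<dots> \<le> real n powr (1/2 + \<beta>)" using n \<beta> by (intro powr_mono) auto
      finally have "success_prob n d \<epsilon> (nat \<lfloor>real n powr (1/2 + \<delta>)\<rfloor>) A \<le> 1/2 + g n / 2"
        unfolding g_def using assms(1-3) \<open>even (n * d)\<close> n \<beta> s small
        by (intro success_prob_asymptotic_bound[where b = b and \<beta> = \<beta>]) (auto simp: b_def)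
      then show "success_prob n d \<epsilon> (nat \<lfloor>real n powr (1/2 + \<delta>)\<rfloor>) A \<le> 1/2 + \<eta>"
        using elim(1) by simp
    qed
  qed
qed

end
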